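(* There exists an absolute constant $\alpha>0$ such that the following holds. Let $p$ be a prime and let $A,B$ be nonempty subsets of $\mathbb{Z}_p$ with $|A|=|B|=n\le\alpha p$. Then there exists a subset $B_{(3)}\subseteq B$ with $|B_{(3)}|\le 3$ such that $|A+B_{(3)}|\ge 2n-1$.
   Context: $\mathbb{Z}_p$ denotes the cyclic group of prime order $p$. For subsets $X,Y$ of an abelian group, $X+Y=\{x+y:x\in X,y\in Y\}$. *)

theory Defs
  imports Complex_Main "HOL-Computational_Algebra.Primes"
begin

text \<open>Z_p is modelled by the residues {0..<p} (natural numbers), with addition mod p.\<close>

definition sumset_mod :: "nat \<Rightarrow> nat set \<Rightarrow> nat set \<Rightarrow> nat set" where
  "sumset_mod p X Y = {(x + y) mod p | x y. x \<in> X \<and> y \<in> Y}"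

end

theory Submission
  imports Defs "HOL-Library.Set_Algebras" "HOL-Library.Real_Mod" "HOL-Analysis.Convex"
begin

text \<open>
  Suppose that every union of three translates of \<open>A\<close> by elements of \<open>B\<close> has at most \<open>2 n - 2\<close>
  elements.

  First, \<open>|B - B| = O(n)\<close>.  If \<open>A + b\<close> were almost disjoint from \<open>A + c\<close> for at least a quarter of the
  \<open>c \<in> B\<close>, then all these \<open>A + c\<close> would almost coincide, and so would the translates of \<open>A\<close> by
  sums of twelve of the differences \<open>c - c\<^sub>0\<close>; by Cauchy--Davenport there are too many of them.  Hence any
  two \<open>b, b' \<in> B\<close> have many common \<open>u\<close> with \<open>b - u\<close> and \<open>b' - u\<close> popular differences of \<open>A\<close>.

  Second, by Petridis' inequality and Ruzsa covering the iterated sumsets of \<open>B\<close> grow polynomially, so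
  some \<open>Q = s B\<close> has bounded doubling and is almost invariant under \<open>B - B\<close>.  A large Fourier
  coefficient of \<open>Q\<close> is a frequency at which all of \<open>B\<close> is concentrated: after a dilation, \<open>B\<close> lies in
  an interval of length \<open>m \<le> p / 400\<close> with both endpoints in \<open>B\<close>.

  Third, as in the integers, translate \<open>A\<close> by the two endpoints and by a random third element of \<open>B\<close>.  Put
  \<open>D = A \<union> (A + m)\<close>, so that \<open>|D| = n + R\<close> with \<open>R\<close> the number of runs of \<open>A\<close> of difference \<open>m\<close>.
  In the integers every window of length \<open>m\<close> meets each run of \<open>D\<close> at most once, and averaging yields \<open>2 n - 1\<close>.
  In the cyclic group runs may wrap around; the loss is controlled by the sparsest window, and it is
  outweighed by the elements of \<open>A\<close> that lie in sparse windows.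
\<close>

section \<open>Sumsets in abelian groups\<close>

lemma sumset_eq_image: "X + Y = (\<lambda>(x, y). x + y) ` (X \<times> Y)"
  by (force simp: set_plus_def)

lemma card_sumset_le:
  assumes "finite X" "finite Y"
  shows "card (X + Y :: 'a::ab_group_add set) \<le> card X * card Y"
  using card_image_le[of "X \<times> Y" "\<lambda>(x, y). x + y"] assms
  by (simp add: sumset_eq_image card_cartesian_product)

lemma card_translate [simp]: "card ((+) (a::'a::ab_group_add) ` X) = card X"
  by (simp add: card_image)

lemma card_negate [simp]: "card (uminus ` (X :: 'a::ab_group_add set)) = card X"
  by (simp add: card_image)

lemma card_le_sumset:
  assumes "finite X" "finite Y" "Y \<noteq> {}"
  shows "card X \<le> card (X + Y :: 'a::ab_group_add set)"
proof -
  obtain y where "y \<in> Y" using assms by blast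
  then have "X + {y} \<subseteq> X + Y" by (auto simp: set_plus_def)
  with assms show ?thesis
    by (metis card_mono card_plus_sing finite_set_plus)
qed

lemma negate_sumset: "uminus ` (X + Y) = uminus ` X + uminus ` (Y :: 'a::ab_group_add set)"
  by (force simp: set_plus_def image_iff)

text \<open>Fix for each \<open>u\<close> in the difference set one way of writing it as
  \<open>v - w\<close>. The map sending \<open>(x, u)\<close> to \<open>(v + x, w + x)\<close> is
  injective, because its coordinates differ by \<open>u\<close>.\<close>

lemma ruzsa_triangle:
  fixes X V W :: "'a::ab_group_add set"
  assumes "finite X" "finite V" "finite W"
  shows "card X * card (V + uminus ` W) \<le> card (V + X) * card (W + X)"
proof -
  have "\<forall>u\<in>V + uminus ` W. \<exists>vw. fst vw \<in> V \<and> snd vw \<in> W \<and> u = fst vw - snd vw"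
    by (force simp: set_plus_def)
  then obtain f where f: "\<And>u. u \<in> V + uminus ` W \<Longrightarrow> fst (f u) \<in> V \<and> snd (f u) \<in> W \<and> u = fst (f u) - snd (f u)"
    by metis
  let ?g = "\<lambda>(x, u). (fst (f u) + x, snd (f u) + x)"
  have "inj_on ?g (X \<times> (V + uminus ` W))"
  proof (rule inj_onI, clarify)
    fix x u x' u'
    assume u: "u \<in> V + uminus ` W" "u' \<in> V + uminus ` W"
      and eq: "fst (f u) + x = fst (f u') + x'" "snd (f u) + x = snd (f u') + x'"
    have "u = (fst (f u) + x) - (snd (f u) + x)" using f[OF u(1)] by simp
    also have "\<dots> = u'" using f[OF u(2)] eq by simp
    finally show "x = x' \<and> u = u'" using eq by simp
  qed
  moreover have "?g ` (X \<times> (V + uminus ` W)) \<subseteq> (V + X) \<times> (W + X)"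
    using f by (auto intro!: set_plus_intro)
  ultimately have "card (X \<times> (V + uminus ` W)) \<le> card ((V + X) \<times> (W + X))"
    using assms by (intro card_inj_on_le) (auto intro: finite_set_plus)
  then show ?thesis by (simp add: card_cartesian_product)
qed

text \<open>The set \<open>X\<close> minimises \<open>|X + B| / |X|\<close>, and the inequality follows by adding the elements of \<open>C\<close> one by one.\<close>

lemma petridis:
  fixes A B :: "'a::ab_group_add set"
  assumes A: "finite A" "A \<noteq> {}" and B: "finite B"
  obtains X where "X \<subseteq> A" "X \<noteq> {}"
    "\<And>C. finite C \<Longrightarrow> card (X + B + C) * card A \<le> card (A + B) * card (X + C)"
proof -
  define r where "r = (\<lambda>X. real (card (X + B)) / real (card X))"
  define F where "F = Pow A - {{}}"
  have "finite F" "F \<noteq> {}" using A unfolding F_def by auto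
  then obtain X where X: "X \<in> F" "\<And>Z. Z \<in> F \<Longrightarrow> r X \<le> r Z"
    using ex_min_if_finite[of "r ` F"] by (metis (no_types, lifting) arg_min_if_finite(1) arg_min_least)
  have fX: "finite X" "X \<noteq> {}" "X \<subseteq> A" using X(1) A finite_subset unfolding F_def by auto
  have cX: "card X > 0" using fX by (simp add: card_gt_0_iff)
  have minr: "r X * card Z \<le> card (Z + B)" if "Z \<subseteq> X" for Z
  proof (cases "Z = {}")
    case False
    then have "Z \<in> F" using that fX unfolding F_def by auto
    moreover have "card Z > 0" using False that fX by (meson card_gt_0_iff finite_subset)
    ultimately show ?thesis using X(2)[of Z] by (simp add: r_def field_simps)
  qed simp
  have main: "real (card (X + B + C)) \<le> r X * card (X + C)" if "finite C" for C
    using that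
  proof (induction C rule: finite_induct)
    case (insert c C)
    \<comment> \<open>\<open>Z\<close> collects the \<open>x\<close> for which
      \<open>x + B + c\<close> brings nothing new; minimality of the ratio, applied to
      \<open>Z\<close>, bounds \<open>card (Z + B)\<close> from below. \<open>W\<close> is the
      analogue for \<open>X + C\<close>, and \<open>W \<subseteq> Z\<close> makes the two increments
      comparable.\<close>
    define Z where "Z = {x\<in>X. (\<lambda>b. x + b + c) ` B \<subseteq> X + B + C}"
    define W where "W = {x\<in>X. x + c \<in> X + C}"
    have ZX: "Z \<subseteq> X" and WX: "W \<subseteq> X" by (auto simp: Z_def W_def)
    have WZ: "W \<subseteq> Z"
    proof
      fix x assume "x \<in> W"
      then obtain y d where "x \<in> X" "y \<in> X" "d \<in> C" "x + c = y + d" by (auto simp: W_def set_plus_def)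
      then have "x + b + c \<in> X + B + C" if "b \<in> B" for b
        using that set_plus_intro[OF set_plus_intro[of y X b B], of d C]
        by (metis add.commute add.left_commute)
      then show "x \<in> Z" using \<open>x \<in> X\<close> by (auto simp: Z_def)
    qed
    have "finite Z" "finite W" using ZX WX fX finite_subset by blast+
    then have fin: "finite (X + B + C)" "finite (X + B)" "finite (X + C)" "finite Z" "finite W" "finite (Z + B)"
      using fX B insert by (auto intro: finite_set_plus)
    have sub: "X + B + insert c C \<subseteq> (X + B + C) \<union> (+) c ` ((X + B) - (Z + B))"
    proof
      fix u assume "u \<in> X + B + insert c C"
      then obtain x b d where u: "x \<in> X" "b \<in> B" "d \<in> insert c C" "u = x + b + d" by (auto simp: set_plus_def)
      show "u \<in> (X + B + C) \<union> (+) c ` ((X + B) - (Z + B))"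
      proof (cases "d \<in> C")
        case True
        then show ?thesis using u by auto
      next
        case False
        then have d: "d = c" using u by simp
        show ?thesis
        proof (cases "x + b \<in> Z + B")
          case True
          then obtain z b' where "z \<in> Z" "b' \<in> B" "x + b = z + b'" by (auto simp: set_plus_def)
          then have "u \<in> X + B + C" using u d by (auto simp: Z_def)
          then show ?thesis by blast
        next
          case False
          then have "x + b \<in> (X + B) - (Z + B)" using u by auto
          then show ?thesis using u d by (auto simp: add.commute)
        qed
      qed
    qed
    have "card (X + B + insert c C) \<le> card ((X + B + C) \<union> (+) c ` ((X + B) - (Z + B)))"
      using sub fin by (intro card_mono) auto
    also have "\<dots> \<le> card (X + B + C) + card ((X + B) - (Z + B))"
      using card_Un_le by (metis card_translate)
    also have "card ((X + B) - (Z + B)) = card (X + B) - card (Z + B)"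
      using fin ZX by (intro card_Diff_subset set_plus_mono2) auto
    finally have up: "card (X + B + insert c C) \<le> card (X + B + C) + (card (X + B) - card (Z + B))" .
    have ZB: "card (Z + B) \<le> card (X + B)" using fin ZX by (intro card_mono set_plus_mono2) auto
    have "(X + C) \<union> (+) c ` (X - W) \<subseteq> X + insert c C"
      by (auto simp: set_plus_def add.commute)
    then have "card ((X + C) \<union> (+) c ` (X - W)) \<le> card (X + insert c C)"
      using fX insert by (intro card_mono finite_set_plus) auto
    moreover have "card ((X + C) \<union> (+) c ` (X - W)) = card (X + C) + card ((+) c ` (X - W))"
      using fin fX by (intro card_Un_disjoint) (auto simp: W_def add.commute)
    moreover have "card ((+) c ` (X - W)) = card X - card W"
      using fin WX by (simp add: card_Diff_subset)
    ultimately have low: "card (X + C) + (card X - card W) \<le> card (X + insert c C)" by simp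
    have WZc: "card W \<le> card Z" "card Z \<le> card X" using WZ ZX fin fX by (auto intro: card_mono)
    have rX: "r X * card X = card (X + B)" using cX by (simp add: r_def)
    have r0: "r X \<ge> 0" by (simp add: r_def)
    have "real (card (X + B + insert c C)) \<le> real (card (X + B + C)) + real (card (X + B)) - real (card (Z + B))"
      using up ZB by linarith
    also have "\<dots> \<le> r X * card (X + C) + r X * card X - r X * card Z"
      using insert.IH minr[OF ZX] rX by linarith
    also have "\<dots> = r X * (real (card (X + C)) + real (card X) - real (card Z))" by (simp add: algebra_simps)
    also have "\<dots> \<le> r X * card (X + insert c C)"
      using low WZc r0 by (intro mult_left_mono) auto
    finally show ?case .
  qed simp
  have rA: "r X \<le> r A" using X(2)[of A] A unfolding F_def by auto
  have cA: "card A > 0" using A by (simp add: card_gt_0_iff)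
  show ?thesis
  proof
    fix C :: "'a set" assume "finite C"
    then have "real (card (X + B + C)) * card A \<le> r X * card (X + C) * card A"
      using main by (intro mult_right_mono) auto
    also have "\<dots> \<le> r A * card (X + C) * card A"
      using rA by (intro mult_right_mono) auto
    also have "\<dots> = card (A + B) * card (X + C)" using cA by (simp add: r_def)
    finally show "card (X + B + C) * card A \<le> card (A + B) * card (X + C)"
      by (metis of_nat_le_iff of_nat_mult)
  qed (use fX in auto)
qed

text \<open>Let \<open>T\<close> be of largest size with disjoint translates \<open>t + B\<close>.
  Disjointness bounds \<open>card T\<close>, and every \<open>s + B\<close> meets one of these
  translates.\<close>

lemma ruzsa_covering:
  fixes S B :: "'a::ab_group_add set"
  assumes "finite S" "finite B" "B \<noteq> {}"
  obtains T where "T \<subseteq> S" "card T * card B \<le> card (S + B)" "S \<subseteq> T + (B + uminus ` B)"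
proof -
  define P where "P = (\<lambda>T. T \<subseteq> S \<and> pairwise (\<lambda>s t. disjnt ((+) s ` B) ((+) t ` B)) T)"
  have "P {}" by (simp add: P_def)
  moreover have "\<forall>T. P T \<longrightarrow> card T \<le> card S" using assms by (auto simp: P_def intro: card_mono)
  ultimately obtain T where T: "P T" "\<And>T'. P T' \<Longrightarrow> card T' \<le> card T"
    using ex_has_greatest_nat[of P "{}" card "card S"] by (metis le_eq_less_or_eq)
  have TS: "T \<subseteq> S" "finite T" using T assms finite_subset by (auto simp: P_def)
  have "T + B = (\<Union>t\<in>T. (+) t ` B)" by (auto simp: set_plus_def)
  moreover have "card (\<Union>t\<in>T. (+) t ` B) = (\<Sum>t\<in>T. card ((+) t ` B))"
    using T(1) TS assms by (intro card_UN_disjoint) (auto simp: P_def pairwise_def disjnt_def)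
  ultimately have "card T * card B = card (T + B)" by simp
  also have "\<dots> \<le> card (S + B)" using TS assms by (intro card_mono set_plus_mono2 finite_set_plus) auto
  finally have 1: "card T * card B \<le> card (S + B)" .
  have "S \<subseteq> T + (B + uminus ` B)"
  proof
    fix s assume s: "s \<in> S"
    have "\<exists>t\<in>T. \<not> disjnt ((+) s ` B) ((+) t ` B)"
    proof (rule ccontr)
      assume a: "\<not> ?thesis"
      have "s \<notin> T" using a assms by (auto simp: disjnt_def)
      moreover have "P (insert s T)"
        using T(1) a s by (auto simp: P_def pairwise_insert disjnt_sym)
      ultimately show False using T(2)[of "insert s T"] TS by simp
    qed
    then obtain t b b' where "t \<in> T" "b \<in> B" "b' \<in> B" "s + b = t + b'" by (auto simp: disjnt_def)
    then have "s = t + (b' + - b)" by (simp add: algebra_simps)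
    then show "s \<in> T + (B + uminus ` B)" using \<open>t \<in> T\<close> \<open>b \<in> B\<close> \<open>b' \<in> B\<close> by blast
  qed
  with that TS 1 show ?thesis by blast
qed

section \<open>Iterated sumsets and their growth\<close>

primrec nsum :: "nat \<Rightarrow> 'a::ab_group_add set \<Rightarrow> 'a set" where
  "nsum 0 B = {0}"
| "nsum (Suc j) B = B + nsum j B"

lemma finite_nsum: "finite B \<Longrightarrow> finite (nsum j B)"
  by (induction j) (auto intro: finite_set_plus)

lemma nsum_nonempty: "B \<noteq> {} \<Longrightarrow> nsum j B \<noteq> {}"
  by (induction j) (auto simp: set_plus_def)

lemma nsum_add: "nsum (i + j) B = nsum i B + nsum j B"
  by (induction i) (simp_all add: add.assoc)

lemma card_nsum_mono:
  assumes "finite B" "B \<noteq> {}" "i \<le> j"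
  shows "card (nsum i B) \<le> card (nsum j B)"
  using assms card_le_sumset[of "nsum i B" "nsum (j - i) B"] nsum_add[of i "j - i" B]
  by (simp add: finite_nsum nsum_nonempty)

text \<open>A \<open>j\<close>-fold sum is determined by the multiplicities of the elements of
  \<open>T\<close>, each at most \<open>j\<close>.\<close>

lemma card_nsum_le:
  fixes T :: "'a::ab_group_add set"
  assumes "finite T"
  shows "card (nsum j T) \<le> (j + 1) ^ card T"
  using assms
proof (induction T arbitrary: j rule: finite_induct)
  case empty
  show ?case by (cases j) auto
next
  case (insert t T)
  \<comment> \<open>The index \<open>i\<close> is the number of times \<open>t\<close> occurs among
    the \<open>j\<close> summands.\<close>
  have sub: "nsum j (insert t T) \<subseteq> (\<Union>i\<le>j. ((+) t ^^ i) ` nsum (j - i) T)" for j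
  proof (induction j)
    case (Suc j)
    show ?case
    proof
      fix u assume "u \<in> nsum (Suc j) (insert t T)"
      then obtain s v where u: "s \<in> insert t T" "v \<in> nsum j (insert t T)" "u = s + v"
        by (auto simp: set_plus_def)
      then obtain i w where iw: "i \<le> j" "w \<in> nsum (j - i) T" "v = ((+) t ^^ i) w" using Suc by blast
      have comm: "s + ((+) t ^^ i) w = ((+) t ^^ i) (s + w)" for i
        by (induction i) (simp_all add: add.left_commute)
      show "u \<in> (\<Union>i\<le>Suc j. ((+) t ^^ i) ` nsum (Suc j - i) T)"
      proof (cases "s = t")
        case True
        then have "u = ((+) t ^^ Suc i) w" using u iw by simp
        then show ?thesis using iw by (intro UN_I[of "Suc i"]) auto
      next
        case False
        then have "s + w \<in> nsum (Suc j - i) T" using u iw by (auto simp: Suc_diff_le)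
        then show ?thesis using iw u comm by (intro UN_I[of i]) auto
      qed
    qed
  qed auto
  have "card (nsum j (insert t T)) \<le> card (\<Union>i\<le>j. ((+) t ^^ i) ` nsum (j - i) T)"
    using insert by (intro card_mono[OF _ sub]) (auto intro: finite_nsum)
  also have "\<dots> \<le> (\<Sum>i\<le>j. card (((+) t ^^ i) ` nsum (j - i) T))"
    by (intro card_UN_le) auto
  also have "\<dots> \<le> (\<Sum>i\<le>j. (j + 1) ^ card T)"
  proof (intro sum_mono)
    fix i
    have "card (((+) t ^^ i) ` nsum (j - i) T) \<le> card (nsum (j - i) T)"
      using insert by (intro card_image_le) (auto intro: finite_nsum)
    also have "\<dots> \<le> (j - i + 1) ^ card T" by (rule insert.IH)
    also have "\<dots> \<le> (j + 1) ^ card T" by (intro power_mono) auto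
    finally show "card (((+) t ^^ i) ` nsum (j - i) T) \<le> (j + 1) ^ card T" .
  qed
  finally show ?case using insert by simp
qed

text \<open>In the usual notation, 2B - B is covered by T + B - B with at most K^4 elements in T. By
  iteration (j+1)B - B lies in jT + B - B, and jT grows only polynomially in j.\<close>

lemma card_nsum_polynomial:
  fixes B :: "'a::ab_group_add set"
  assumes B: "finite B" "B \<noteq> {}" and K: "card (B + uminus ` B) \<le> K * card B"
  shows "card (nsum (Suc j) B) \<le> (j + 1) ^ (K ^ 4) * (K * card B)"
proof -
  define U where "U = uminus ` B"
  have U: "finite U" "U \<noteq> {}" "card U = card B" using B by (auto simp: U_def)
  have cB: "card B > 0" using B by (simp add: card_gt_0_iff)
  obtain X where X: "X \<subseteq> B" "X \<noteq> {}"
    and pet: "\<And>C. finite C \<Longrightarrow> card (X + U + C) * card B \<le> card (B + U) * card (X + C)"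
    using petridis[OF B U(1)] by metis
  have step: "card (X + U + C) \<le> K * card (X + C)" if "finite C" for C
  proof -
    have "card (X + U + C) * card B \<le> card (B + U) * card (X + C)" by (rule pet[OF that])
    also have "\<dots> \<le> K * card B * card (X + C)" using K by (simp add: U_def)
    also have "\<dots> = K * card (X + C) * card B" by simp
    finally show ?thesis using cB by simp
  qed
  have fX: "finite X" using X B finite_subset by auto
  have cX: "card X > 0" using fX X by (simp add: card_gt_0_iff)
  have iter: "card (X + nsum i U) \<le> K ^ i * card X" for i
  proof (induction i)
    case (Suc i)
    have "card (X + nsum (Suc i) U) = card (X + U + nsum i U)" by (simp add: add.assoc)
    also have "\<dots> \<le> K * card (X + nsum i U)" using U by (intro step finite_nsum) auto
    also have "\<dots> \<le> K * (K ^ i * card X)" using Suc by simp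
    finally show ?case by (simp add: ac_simps)
  qed simp
  \<comment> \<open>Through \<open>X\<close>, the triangle inequality combines the bounds on X - 3B
    and X - B into one on B - 3B, the negative of \<open>S + B\<close> below.\<close>
  have "card X * card (nsum 3 U + uminus ` U) \<le> card (nsum 3 U + X) * card (U + X)"
    using fX U by (intro ruzsa_triangle finite_nsum) auto
  also have "\<dots> \<le> (K ^ 3 * card X) * (K ^ 1 * card X)"
    using iter[of 3] iter[of 1] by (intro mult_le_mono) (simp_all add: add.commute)
  also have "\<dots> = card X * (K ^ 4 * card X)" by (simp add: power4_eq_xxxx power3_eq_cube)
  finally have "card (nsum 3 U + uminus ` U) \<le> K ^ 4 * card X" using cX by simp
  also have "\<dots> \<le> K ^ 4 * card B" using X B by (simp add: card_mono)
  finally have 3: "card (nsum 3 U + uminus ` U) \<le> K ^ 4 * card B" .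
  define S where "S = B + B + uminus ` B"
  have fS: "finite S" using B by (auto simp: S_def intro!: finite_set_plus)
  have "uminus ` (S + B) = nsum 3 U + uminus ` U"
    by (simp add: S_def U_def negate_sumset numeral_3_eq_3 ac_simps)
  then have "card (S + B) \<le> K ^ 4 * card B" using 3 by (metis card_negate)
  moreover obtain T where T: "T \<subseteq> S" "card T * card B \<le> card (S + B)" "S \<subseteq> T + (B + uminus ` B)"
    using ruzsa_covering[OF fS B] by metis
  ultimately have "card T * card B \<le> K ^ 4 * card B" by linarith
  then have cT: "card T \<le> K ^ 4" using cB by simp
  have fT: "finite T" using T fS finite_subset by auto
  have sub: "nsum (Suc i) B + uminus ` B \<subseteq> nsum i T + (B + uminus ` B)" for i
  proof (induction i)
    case (Suc i)
    have "nsum (Suc (Suc i)) B + uminus ` B = B + (nsum (Suc i) B + uminus ` B)" by (simp add: add.assoc)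
    also have "\<dots> \<subseteq> B + (nsum i T + (B + uminus ` B))" by (rule set_plus_mono2[OF subset_refl Suc])
    also have "\<dots> = nsum i T + S" by (simp add: S_def ac_simps)
    also have "\<dots> \<subseteq> nsum i T + (T + (B + uminus ` B))" by (rule set_plus_mono2[OF subset_refl T(3)])
    also have "\<dots> = nsum (Suc i) T + (B + uminus ` B)" by (simp add: ac_simps)
    finally show ?case .
  qed simp
  have "card (nsum (Suc j) B) \<le> card (nsum (Suc j) B + uminus ` B)"
    using B by (intro card_le_sumset finite_nsum) auto
  also have "\<dots> \<le> card (nsum j T + (B + uminus ` B))"
    using B fT by (intro card_mono[OF _ sub] finite_set_plus finite_nsum) auto
  also have "\<dots> \<le> card (nsum j T) * card (B + uminus ` B)"
    using B fT by (intro card_sumset_le finite_set_plus finite_nsum) auto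
  also have "\<dots> \<le> (j + 1) ^ (K ^ 4) * (K * card B)"
  proof (intro mult_le_mono K)
    show "card (nsum j T) \<le> (j + 1) ^ K ^ 4"
      using card_nsum_le[OF fT, of j] power_increasing[OF cT, of "j + 1"] by linarith
  qed
  finally show ?thesis .
qed

text \<open>
  The last assumption is all that is used about a group of prime order \<open>p\<close>.  The proof is Dyson's
  \<open>e\<close>-transform, which preserves \<open>|X| + |Y|\<close> and shrinks \<open>Y\<close>.
\<close>

lemma cauchy_davenport:
  fixes X Y :: "'a::ab_group_add set"
  assumes "finite X" "X \<noteq> {}" "finite Y" "Y \<noteq> {}"
    and "\<And>S d. finite S \<Longrightarrow> S \<noteq> {} \<Longrightarrow> d \<in> Y + uminus ` Y \<Longrightarrow> d \<noteq> 0 \<Longrightarrow> (+) d ` S \<subseteq> S \<Longrightarrow> p \<le> card S"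
  shows "min p (card X + card Y - 1) \<le> card (X + Y)"
  using assms
proof (induction "card Y" arbitrary: X Y rule: less_induct)
  case less
  note closed = less.prems(5)
  show ?case
  proof (cases "\<exists>y1\<in>Y. \<exists>y2\<in>Y. y1 \<noteq> y2")
    case False
    then obtain y where "Y = {y}" using less.prems by blast
    then show ?thesis by (simp add: card_plus_sing)
  next
    case True
    then obtain y1 y2 where y: "y1 \<in> Y" "y2 \<in> Y" "y1 \<noteq> y2" by blast
    define d where "d = y2 - y1"
    have d: "d \<noteq> 0" "d \<in> Y + uminus ` Y" using y by (auto simp: d_def set_plus_def)
    show ?thesis
    proof (cases "(+) d ` X \<subseteq> X")
      case True
      then have "p \<le> card X" using closed[of X d] less.prems d by blast
      then show ?thesis using card_le_sumset[of X Y] less.prems by linarith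
    next
      case False
      then obtain e where e: "e \<in> X" "d + e \<notin> X" by blast
      \<comment> \<open>This shift carries \<open>y1\<close> to \<open>e\<close>, which lies in
        \<open>X\<close>, and \<open>y2\<close> to \<open>d + e\<close>, which does not. Hence
        \<open>Y'\<close> is nonempty and smaller than \<open>Y\<close>.\<close>
      define f where "f = e - y1"
      define Y1 where "Y1 = (+) f ` Y"
      define X' where "X' = X \<union> Y1"
      define Y' where "Y' = X \<inter> Y1"
      have fin: "finite Y1" "finite X'" "finite Y'" using less.prems by (auto simp: Y1_def X'_def Y'_def)
      have "e \<in> Y1" using y by (auto simp: Y1_def f_def image_iff intro!: bexI[of _ y1])
      then have ne: "Y' \<noteq> {}" using e by (auto simp: Y'_def)
      have "d + e \<in> Y1" using y by (auto simp: Y1_def f_def d_def image_iff intro!: bexI[of _ y2])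
      then have "Y' \<subset> Y1" using e by (auto simp: Y'_def)
      then have lt: "card Y' < card Y" using fin psubset_card_mono[of Y1 Y'] by (simp add: Y1_def)
      \<comment> \<open>Differences of \<open>Y'\<close> are differences of \<open>Y\<close>, so the
        hypothesis on translation-closed sets is inherited.\<close>
      have diff: "Y' + uminus ` Y' \<subseteq> Y + uminus ` Y"
      proof
        fix u assume "u \<in> Y' + uminus ` Y'"
        then obtain a b where "a \<in> Y" "b \<in> Y" "u = (f + a) + - (f + b)"
          by (auto simp: Y'_def Y1_def set_plus_def)
        then have "u = a + - b" by simp
        then show "u \<in> Y + uminus ` Y" using \<open>a \<in> Y\<close> \<open>b \<in> Y\<close> by blast
      qed
      have sum: "card X' + card Y' = card X + card Y"
        using card_Un_Int[of X Y1] fin less.prems by (simp add: X'_def Y'_def Y1_def)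
      have "X' + Y' \<subseteq> X + Y1"
        by (auto simp: X'_def Y'_def set_plus_def) (metis add.commute)
      also have "X + Y1 = (+) f ` (X + Y)"
        by (force simp: Y1_def set_plus_def image_iff add.left_commute)
      finally have "card (X' + Y') \<le> card (X + Y)"
        using less.prems by (metis card_mono card_translate finite_imageI finite_set_plus)
      moreover have "min p (card X' + card Y' - 1) \<le> card (X' + Y')"
        using lt fin ne less.prems(2) diff closed
        by (intro less.hyps) (auto simp: X'_def)
      ultimately show ?thesis using sum by simp
    qed
  qed
qed

lemma card_nsum_ge:
  fixes Q :: "'a::ab_group_add set"
  assumes "finite Q" "Q \<noteq> {}" "p > 0"
    and "\<And>S d. finite S \<Longrightarrow> S \<noteq> {} \<Longrightarrow> d \<in> Q + uminus ` Q \<Longrightarrow> d \<noteq> 0 \<Longrightarrow> (+) d ` S \<subseteq> S \<Longrightarrow> p \<le> card S"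
  shows "min p (j * (card Q - 1) + 1) \<le> card (nsum j Q)"
proof (induction j)
  case 0
  then show ?case by simp
next
  case (Suc j)
  have "min p (card (nsum j Q) + card Q - 1) \<le> card (nsum j Q + Q)"
    using assms finite_nsum[of Q j] nsum_nonempty[of Q j] by (intro cauchy_davenport) blast+
  moreover have "nsum j Q + Q = nsum (Suc j) Q" by (simp add: add.commute)
  moreover have "card Q > 0" using assms by (simp add: card_gt_0_iff)
  ultimately show ?case using Suc by (auto simp: min_def split: if_splits)
qed

section \<open>Popular differences\<close>

lemma card_fibres_le:
  fixes k :: real
  assumes "finite P" "finite Z" "\<And>z. z \<in> Z \<Longrightarrow> k \<le> real (card {q \<in> P. f q = z})"
  shows "k * real (card Z) \<le> real (card P)"
proof -
  have "k * real (card Z) = (\<Sum>z\<in>Z. k)" by simp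
  also have "\<dots> \<le> (\<Sum>z\<in>Z. real (card {q \<in> P. f q = z}))" by (intro sum_mono assms)
  also have "\<dots> = real (card (\<Union>z\<in>Z. {q \<in> P. f q = z}))"
    using assms by (subst card_UN_disjoint) auto
  also have "\<dots> \<le> real (card P)" using assms by (intro of_nat_mono card_mono) auto
  finally show ?thesis .
qed

text \<open>Equivalently, the number of representations of \<open>x\<close> as a difference of two
  elements of \<open>A\<close>.\<close>

definition overlap :: "'a::ab_group_add set \<Rightarrow> 'a \<Rightarrow> nat" where
  "overlap A x = card (A \<inter> (+) x ` A)"

lemma overlap_0: "overlap A 0 = card A"
  by (simp add: overlap_def)

lemma overlap_translates: "card ((+) b ` A \<inter> (+) c ` A) = overlap A (c - b)"
proof -
  have "(+) b ` A \<inter> (+) c ` A = (+) b ` (A \<inter> (+) (c - b) ` A)"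
    by (subst image_Int) (auto simp: image_image algebra_simps)
  then show ?thesis by (simp add: overlap_def)
qed

text \<open>The defect \<open>card A - overlap A x\<close> is subadditive: \<open>A\<close> and
  \<open>x + y + A\<close> each meet \<open>x + A\<close> in a large subset, and two large subsets
  of \<open>x + A\<close> intersect.\<close>

lemma overlap_add:
  assumes "finite A"
  shows "overlap A x + overlap A y \<le> overlap A (x + y) + card A"
proof -
  let ?P = "A \<inter> (+) x ` A" and ?Q = "(+) x ` A \<inter> (+) (x + y) ` A"
  have "card ?P + card ?Q = card (?P \<union> ?Q) + card (?P \<inter> ?Q)" using assms by (intro card_Un_Int) auto
  moreover have "card (?P \<union> ?Q) \<le> card ((+) x ` A)" using assms by (intro card_mono) auto
  moreover have "card (?P \<inter> ?Q) \<le> overlap A (x + y)"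
    unfolding overlap_def using assms by (intro card_mono) auto
  moreover have "card ?Q = overlap A y" by (simp add: overlap_translates)
  ultimately show ?thesis by (simp add: overlap_def)
qed

lemma overlap_eq_card_differences: "overlap A x = card {q \<in> A \<times> A. fst q - snd q = x}"
proof -
  have "bij_betw (\<lambda>a. (a, a - x)) (A \<inter> (+) x ` A) {q \<in> A \<times> A. fst q - snd q = x}"
    by (rule bij_betw_byWitness[where f' = fst]) auto
  then show ?thesis unfolding overlap_def by (rule bij_betw_same_card)
qed

text \<open>Distinct differences use up disjoint sets of pairs in
  \<open>A \<times> A\<close>.\<close>

lemma card_popular_le:
  assumes "finite A" "finite S" "\<And>x. x \<in> S \<Longrightarrow> k \<le> real (overlap A x)"
  shows "k * real (card S) \<le> (real (card A))\<^sup>2"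
  using card_fibres_le[of "A \<times> A" S k "\<lambda>q. fst q - snd q"] assms
  by (simp add: overlap_eq_card_differences card_cartesian_product power2_eq_square)

text \<open>Bonferroni's inequality for a union of three sets.\<close>

lemma card_three_translates:
  assumes "finite A"
  shows "3 * card A \<le> card (A + {x, y, z}) + overlap A (y - x) + overlap A (z - x) + overlap A (z - y)"
proof -
  let ?T = "\<lambda>b. (+) b ` A"
  have eq: "A + {x, y, z} = ?T x \<union> ?T y \<union> ?T z" by (auto simp: set_plus_def add.commute image_iff)
  have 1: "card (?T x) + card (?T y) = card (?T x \<union> ?T y) + card (?T x \<inter> ?T y)"
    using assms by (intro card_Un_Int) auto
  have 2: "card (?T x \<union> ?T y) + card (?T z) = card (?T x \<union> ?T y \<union> ?T z) + card ((?T x \<union> ?T y) \<inter> ?T z)"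
    using assms by (intro card_Un_Int) auto
  have 3: "card ((?T x \<union> ?T y) \<inter> ?T z) \<le> card (?T x \<inter> ?T z) + card (?T y \<inter> ?T z)"
    unfolding Int_Un_distrib2 by (rule card_Un_le)
  show ?thesis using 1 2 3 unfolding overlap_translates eq card_translate by linarith
qed

section \<open>A good scale under polynomial growth\<close>

text \<open>A gain of more than \<open>4 ^ (N + 1)\<close> at every scale \<open>4 ^ i * L0\<close>
  would beat the polynomial bound, so on some \<open>[L, 4 * L]\<close> the gain is at most that.
  The first part \<open>[L, 2 * L]\<close> has too many steps for each to gain a factor
  \<open>1 + \<epsilon>\<close>. The bound \<open>\<Lambda>\<close> serves all \<open>g\<close> and
  \<open>c\<close> at once.\<close>

lemma growth_pigeonhole:
  fixes K \<epsilon> :: real and N :: nat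
  assumes "\<epsilon> > 0"
  obtains \<Lambda> :: nat where "\<Lambda> \<ge> 1"
    "\<And>g c. mono g \<Longrightarrow> 0 < c \<Longrightarrow> (\<And>j. j \<ge> 1 \<Longrightarrow> c \<le> g j \<and> g j \<le> K * c * real j ^ N) \<Longrightarrow>
       \<exists>s. 1 \<le> s \<and> s \<le> \<Lambda> \<and> g (Suc s) \<le> (1 + \<epsilon>) * g s \<and> g (2 * s) \<le> 4 ^ (N + 1) * (g s :: real)"
proof -
  define M :: real where "M = 4 ^ (N + 1)"
  have M0: "M > 0" by (simp add: M_def)
  \<comment> \<open>By Bernoulli's inequality, at least \<open>L0\<close> steps of factor
    \<open>1 + \<epsilon>\<close> multiply to more than \<open>M\<close>.\<close>
  obtain L0 :: nat where L0: "M < real L0 * \<epsilon>" using assms reals_Archimedean3 by blast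
  have "real L0 * \<epsilon> > 0" using L0 M0 by linarith
  then have L0': "L0 \<ge> 1" by (cases L0) auto
  \<comment> \<open>Since \<open>M ^ I = 4 ^ I * (4 ^ I) ^ N\<close>, a gain of \<open>M ^ I\<close>
    exceeds the polynomial bound at \<open>4 ^ I * L0\<close>.\<close>
  obtain I :: nat where I: "K * real L0 ^ N < 4 ^ I" using real_arch_pow[of 4] by auto
  define \<Lambda> where "\<Lambda> = 2 * (4 ^ I * L0)"
  show ?thesis
  proof
    show "\<Lambda> \<ge> 1" using L0' by (simp add: \<Lambda>_def)
    fix g :: "nat \<Rightarrow> real" and c :: real
    assume g: "mono g" "0 < c" "\<And>j. j \<ge> 1 \<Longrightarrow> c \<le> g j \<and> g j \<le> K * c * real j ^ N"
    have "\<exists>i<I. g (4 * (4 ^ i * L0)) \<le> M * g (4 ^ i * L0)"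
    proof (rule ccontr)
      assume "\<not> ?thesis"
      then have step: "M * g (4 ^ i * L0) < g (4 ^ Suc i * L0)" if "i < I" for i
        using that by (force simp: ac_simps)
      have "M ^ i * c \<le> g (4 ^ i * L0)" if "i \<le> I" for i
        using that
      proof (induction i)
        case 0
        then show ?case using g(3)[OF L0'] by simp
      next
        case (Suc i)
        then have "M * (M ^ i * c) \<le> M * g (4 ^ i * L0)" using M0 by (intro mult_left_mono) auto
        then show ?case using step[of i] Suc.prems by simp
      qed
      then have "M ^ I * c \<le> g (4 ^ I * L0)" by simp
      also have "\<dots> \<le> K * c * real (4 ^ I * L0) ^ N" using g(3)[of "4 ^ I * L0"] L0' by simp
      also have "\<dots> = (K * real L0 ^ N) * (c * (4 ^ I) ^ N)" by (simp add: power_mult_distrib)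
      also have "\<dots> < 4 ^ I * (c * (4 ^ I) ^ N)" using I g(2) by (intro mult_strict_right_mono) auto
      also have "\<dots> = M ^ I * c"
        by (simp add: M_def power_mult_distrib mult.commute[of N] flip: power_mult)
      finally show False by simp
    qed
    then obtain i where i: "i < I" "g (4 * (4 ^ i * L0)) \<le> M * g (4 ^ i * L0)" by blast
    define L where "L = 4 ^ i * L0"
    have L: "L \<ge> L0" "L \<ge> 1" using L0' by (auto simp: L_def)
    have L\<Lambda>: "2 * L \<le> \<Lambda>" using i(1) by (simp add: L_def \<Lambda>_def power_increasing)
    have gL: "g L > 0" using g(3)[of L] g(2) L by linarith
    have "\<exists>k<L. g (Suc (L + k)) \<le> (1 + \<epsilon>) * g (L + k)"
    proof (rule ccontr)
      assume "\<not> ?thesis"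
      then have step: "(1 + \<epsilon>) * g (L + k) < g (L + Suc k)" if "k < L" for k
        using that by force
      have "(1 + \<epsilon>) ^ k * g L \<le> g (L + k)" if "k \<le> L" for k
        using that
      proof (induction k)
        case (Suc k)
        then have "(1 + \<epsilon>) * ((1 + \<epsilon>) ^ k * g L) \<le> (1 + \<epsilon>) * g (L + k)" using assms by (intro mult_left_mono) auto
        then show ?case using step[of k] Suc.prems by simp
      qed simp
      from this[of L] have "(1 + \<epsilon>) ^ L * g L \<le> g (2 * L)" by (simp add: mult_2)
      moreover have "M < (1 + \<epsilon>) ^ L"
      proof -
        have "M < real L * \<epsilon>"
          using L0 L assms by (meson less_le_trans mult_right_mono of_nat_le_iff less_imp_le)
        also have "\<dots> \<le> (1 + \<epsilon>) ^ L" using Bernoulli_inequality[of \<epsilon> L] assms by simp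
        finally show ?thesis .
      qed
      then have "M * g L < (1 + \<epsilon>) ^ L * g L" using gL by simp
      moreover have "g (2 * L) \<le> g (4 * L)" using g(1) by (simp add: monoD)
      ultimately show False using i(2) by (simp add: L_def)
    qed
    then obtain k where k: "k < L" "g (Suc (L + k)) \<le> (1 + \<epsilon>) * g (L + k)" by blast
    have "g (2 * (L + k)) \<le> g (4 * L)" using g(1) k by (simp add: monoD)
    also have "\<dots> \<le> M * g L" using i(2) by (simp add: L_def)
    also have "\<dots> \<le> M * g (L + k)" using g(1) M0 by (simp add: monoD)
    finally show "\<exists>s. 1 \<le> s \<and> s \<le> \<Lambda> \<and> g (Suc s) \<le> (1 + \<epsilon>) * g s \<and> g (2 * s) \<le> 4 ^ (N + 1) * g s"
      using k L L\<Lambda> unfolding M_def by (intro exI[of _ "L + k"]) auto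
  qed
qed

section \<open>Fourier analysis on roots of unity\<close>

text \<open>The circle group contains a copy of \<open>Z_p\<close> for every \<open>p\<close>, and its characters are the powers of the inclusion.\<close>

typedef circle = "{z :: complex. cmod z = 1}" morphisms cval circ
  by (rule exI[of _ 1]) simp

setup_lifting type_definition_circle

instantiation circle :: ab_group_add
begin

lift_definition zero_circle :: circle is 1 by simp
lift_definition plus_circle :: "circle \<Rightarrow> circle \<Rightarrow> circle" is "(*)" by (simp add: norm_mult)
lift_definition uminus_circle :: "circle \<Rightarrow> circle" is inverse by (simp add: norm_inverse)
lift_definition minus_circle :: "circle \<Rightarrow> circle \<Rightarrow> circle" is "(/)" by (simp add: norm_divide)

instance
  by standard (transfer; force simp: field_simps)+

end

lift_definition rot :: "real \<Rightarrow> circle" is cis by simp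

lemma cval_simps [simp]:
  "cval 0 = 1" "cval (x + y) = cval x * cval y" "cval (- x) = inverse (cval x)"
  "cval (x - y) = cval x / cval y" "cval (rot a) = cis a"
  by (transfer; simp)+

lemma norm_cval [simp]: "cmod (cval x) = 1"
  using cval[of x] by simp

definition roots :: "nat \<Rightarrow> circle set" where
  "roots p = {z. cval z ^ p = 1}"

lemma roots_sumset: "X \<subseteq> roots p \<Longrightarrow> Y \<subseteq> roots p \<Longrightarrow> X + Y \<subseteq> roots p"
  by (fastforce simp: roots_def set_plus_def power_mult_distrib subset_iff)

lemma roots_nsum: "X \<subseteq> roots p \<Longrightarrow> nsum j X \<subseteq> roots p"
  by (induction j) (auto simp: roots_sumset, auto simp: roots_def)

lemma roots_diff: "x \<in> roots p \<Longrightarrow> y \<in> roots p \<Longrightarrow> x - y \<in> roots p"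
  by (simp add: roots_def power_divide)

lemma sum_powers_root:
  assumes "z \<in> roots p"
  shows "(\<Sum>t<p. cval z ^ t) = (if z = 0 then of_nat p else 0)"
proof (cases "z = 0")
  case False
  then have "cval z \<noteq> 1" by (metis cval_inject cval_simps(1))
  then show ?thesis using assms False by (simp add: sum_gp_strict roots_def)
qed simp

text \<open>Expanding the square leaves sums of powers of \<open>z - w\<close>, which vanish unless
  \<open>z = w\<close>.\<close>

lemma parseval:
  fixes r :: "circle \<Rightarrow> real"
  assumes "finite S" "S \<subseteq> roots p"
  shows "(\<Sum>t<p. (cmod (\<Sum>z\<in>S. of_real (r z) * cval z ^ t))\<^sup>2) = real p * (\<Sum>z\<in>S. (r z)\<^sup>2)"
proof -
  have cnj: "cnj (cval z) = inverse (cval z)" for z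
    by (metis complex_norm_square norm_cval inverse_unique of_real_1 power_one)
  have "complex_of_real (\<Sum>t<p. (cmod (\<Sum>z\<in>S. of_real (r z) * cval z ^ t))\<^sup>2)
      = (\<Sum>t<p. (\<Sum>z\<in>S. of_real (r z) * cval z ^ t) * (\<Sum>w\<in>S. of_real (r w) * cnj (cval w) ^ t))"
    by (simp add: complex_norm_square del: of_real_power)
  also have "\<dots> = (\<Sum>t<p. \<Sum>z\<in>S. \<Sum>w\<in>S. of_real (r z * r w) * cval (z - w) ^ t)"
    by (simp add: sum_product cnj power_divide divide_inverse power_inverse power_mult_distrib ac_simps)
  also have "\<dots> = (\<Sum>z\<in>S. \<Sum>w\<in>S. of_real (r z * r w) * (\<Sum>t<p. cval (z - w) ^ t))"
    by (subst sum.swap, intro sum.cong refl, subst sum.swap) (simp add: sum_distrib_left)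
  also have "\<dots> = (\<Sum>z\<in>S. \<Sum>w\<in>S. of_real (r z * r w) * (if z = w then of_nat p else 0))"
  proof (intro sum.cong refl arg_cong2[of _ _ _ _ "(*)"])
    fix z w assume "z \<in> S" "w \<in> S"
    then have "z - w \<in> roots p" using assms by (intro roots_diff) auto
    then show "(\<Sum>t<p. cval (z - w) ^ t) = (if z = w then of_nat p else 0)"
      by (subst sum_powers_root) auto
  qed
  also have "\<dots> = (\<Sum>z\<in>S. of_real (r z * r z) * of_nat p)"
    using assms by (simp add: if_distrib sum.delta cong: if_cong)
  also have "\<dots> = complex_of_real (real p * (\<Sum>z\<in>S. (r z)\<^sup>2))"
    by (simp add: sum_distrib_left power2_eq_square ac_simps)
  finally show ?thesis using of_real_eq_iff by blast
qed

text \<open>By Cauchy--Schwarz a small sumset forces large additive energy, and the energy is a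
  fourth moment of the Fourier coefficients. Were all coefficients at nonzero frequencies small, the
  second moment would make this fourth moment too small.\<close>

lemma large_coefficient:
  assumes Q: "finite Q" "Q \<noteq> {}" "Q \<subseteq> roots p"
    and M: "real (card (Q + Q)) \<le> M * real (card Q)" "2 * M * real (card Q) < real p"
  shows "\<exists>t\<in>{1..<p}. (real (card Q))\<^sup>2 \<le> 2 * M * (cmod (\<Sum>q\<in>Q. cval q ^ t))\<^sup>2"
proof (rule ccontr)
  assume neg: "\<not> ?thesis"
  define F where "F = (\<lambda>t. \<Sum>q\<in>Q. cval q ^ t)"
  \<comment> \<open>The representation function of \<open>Q + Q\<close>; its transform is the square
    of \<open>F\<close>, so \<open>parseval\<close> for \<open>r\<close> computes the fourth moment
    of \<open>F\<close>.\<close>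
  define r where "r = (\<lambda>z. real (card {q \<in> Q \<times> Q. fst q + snd q = z}))"
  define k where "k = real (card Q)"
  have k: "k > 0" using Q by (simp add: k_def card_gt_0_iff)
  have "card Q \<le> card (Q + Q)" using Q card_le_sumset by blast
  then have "k \<le> M * k" using M by (simp add: k_def)
  then have M1: "M \<ge> 1" using k by simp
  have "M * k > 0" using M1 k by simp
  then have p: "p > 0" using M(2) by (cases p) (auto simp: k_def)
  have fin: "finite (Q + Q)" using Q by (intro finite_set_plus) auto
  have conv: "(\<Sum>z\<in>Q + Q. of_real (r z) * h z) = (\<Sum>q\<in>Q \<times> Q. h (fst q + snd q))" for h :: "circle \<Rightarrow> complex"
  proof -
    have "(\<Sum>q\<in>Q \<times> Q. h (fst q + snd q)) = (\<Sum>z\<in>Q + Q. \<Sum>q\<in>{q \<in> Q \<times> Q. fst q + snd q = z}. h (fst q + snd q))"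
      using Q fin by (intro sum.group[symmetric]) auto
    also have "\<dots> = (\<Sum>z\<in>Q + Q. \<Sum>q\<in>{q \<in> Q \<times> Q. fst q + snd q = z}. h z)"
      by (intro sum.cong) auto
    finally show ?thesis by (simp add: r_def)
  qed
  have F2: "(\<Sum>z\<in>Q + Q. of_real (r z) * cval z ^ t) = (F t)\<^sup>2" for t
    by (simp add: conv F_def power2_eq_square sum_product sum.cartesian_product case_prod_beta power_mult_distrib)
  have "of_real (\<Sum>z\<in>Q + Q. r z) = (of_real (k\<^sup>2) :: complex)"
    using conv[of "\<lambda>_. 1"] by (simp add: card_cartesian_product k_def power2_eq_square)
  then have sumr: "(\<Sum>z\<in>Q + Q. r z) = k\<^sup>2" using of_real_eq_iff by blast
  have "(k\<^sup>2)\<^sup>2 \<le> real (card (Q + Q)) * (\<Sum>z\<in>Q + Q. (r z)\<^sup>2)"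
    using sum_squared_le_sum_of_squares[of r "Q + Q"] by (simp add: sumr mult.commute)
  also have "\<dots> \<le> M * k * (\<Sum>z\<in>Q + Q. (r z)\<^sup>2)"
    using M by (intro mult_right_mono sum_nonneg) (auto simp: k_def)
  finally have "k * (k * k\<^sup>2) \<le> k * (M * (\<Sum>z\<in>Q + Q. (r z)\<^sup>2))" by (simp add: power2_eq_square ac_simps)
  then have energy: "k * k\<^sup>2 \<le> M * (\<Sum>z\<in>Q + Q. (r z)\<^sup>2)" using k by simp
  have P2: "(\<Sum>t<p. (cmod (F t))\<^sup>2) = real p * k"
    using parseval[OF Q(1,3), of "\<lambda>_. 1"] by (simp add: F_def k_def)
  have P4: "(\<Sum>t<p. ((cmod (F t))\<^sup>2)\<^sup>2) = real p * (\<Sum>z\<in>Q + Q. (r z)\<^sup>2)"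
    using parseval[OF fin roots_sumset[OF Q(3) Q(3)], of r] by (simp add: F2 norm_power)
  have split: "(\<Sum>t<p. f t) = f 0 + (\<Sum>t\<in>{1..<p}. f t)" for f :: "nat \<Rightarrow> real"
    using p by (simp add: sum.atLeast_Suc_lessThan lessThan_atLeast0)
  have F0: "cmod (F 0) = k" by (simp add: F_def k_def)
  have "2 * M * (\<Sum>t\<in>{1..<p}. ((cmod (F t))\<^sup>2)\<^sup>2) = (\<Sum>t\<in>{1..<p}. 2 * M * (cmod (F t))\<^sup>2 * (cmod (F t))\<^sup>2)"
    by (simp add: sum_distrib_left power2_eq_square ac_simps)
  also have "\<dots> \<le> (\<Sum>t\<in>{1..<p}. k\<^sup>2 * (cmod (F t))\<^sup>2)"
    using neg by (intro sum_mono mult_right_mono) (auto simp: F_def k_def not_le intro: less_imp_le)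
  also have "\<dots> = k\<^sup>2 * (real p * k - k\<^sup>2)"
    using split[of "\<lambda>t. (cmod (F t))\<^sup>2"] P2 F0 by (simp flip: sum_distrib_left)
  finally have "2 * M * (\<Sum>t\<in>{1..<p}. ((cmod (F t))\<^sup>2)\<^sup>2) \<le> k\<^sup>2 * (real p * k - k\<^sup>2)" .
  moreover have "(\<Sum>t\<in>{1..<p}. ((cmod (F t))\<^sup>2)\<^sup>2) = real p * (\<Sum>z\<in>Q + Q. (r z)\<^sup>2) - (k\<^sup>2)\<^sup>2"
    using split[of "\<lambda>t. ((cmod (F t))\<^sup>2)\<^sup>2"] unfolding P4 F0 by simp
  ultimately have "2 * M * (real p * (\<Sum>z\<in>Q + Q. (r z)\<^sup>2) - (k\<^sup>2)\<^sup>2) \<le> k\<^sup>2 * (real p * k - k\<^sup>2)" by simp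
  moreover have "real p * (k * k\<^sup>2) \<le> real p * (M * (\<Sum>z\<in>Q + Q. (r z)\<^sup>2))"
    using energy by (intro mult_left_mono) auto
  ultimately have "real p * (k * k\<^sup>2) + (k\<^sup>2)\<^sup>2 \<le> 2 * M * (k\<^sup>2)\<^sup>2" by (simp add: algebra_simps)
  then have "k ^ 3 * (real p + k) \<le> k ^ 3 * (2 * M * k)"
    by (simp add: power2_eq_square power3_eq_cube algebra_simps)
  then have "real p + k \<le> 2 * M * k" using k by simp
  then show False using M(2) k by (simp add: k_def)
qed

text \<open>
  For \<open>Q = nsum s B\<close> the sets \<open>b + Q\<close> and \<open>c + Q\<close> nearly coincide, so
  \<open>b\<^sup>t \<noteq> c\<^sup>t\<close> is incompatible with a large coefficient of \<open>Q\<close> at \<open>t\<close>.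
\<close>

lemma exists_concentrating_frequency:
  fixes K :: nat and \<delta> :: real
  assumes "\<delta> > 0"
  obtains \<alpha> :: real where "\<alpha> > 0"
    "\<And>p B. finite B \<Longrightarrow> B \<noteq> {} \<Longrightarrow> B \<subseteq> roots p \<Longrightarrow> card (B + uminus ` B) \<le> K * card B \<Longrightarrow>
       real (card B) \<le> \<alpha> * real p \<Longrightarrow>
       \<exists>t\<in>{1..<p}. \<forall>b\<in>B. \<forall>c\<in>B. (cmod (cval b ^ t - cval c ^ t))\<^sup>2 \<le> \<delta>"
proof -
  define N where "N = K ^ 4"
  define M :: real where "M = 4 ^ (N + 1)"
  \<comment> \<open>Chosen so that the factor \<open>2 * M\<close> from the large coefficient and
    the factor \<open>4 * \<epsilon>\<^sup>2\<close> from comparing translates multiply to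
    \<open>\<delta>\<close>.\<close>
  define \<epsilon> where "\<epsilon> = sqrt (\<delta> / (8 * M))"
  have M: "M > 0" by (simp add: M_def)
  have \<epsilon>: "\<epsilon> > 0" "8 * M * \<epsilon>\<^sup>2 = \<delta>" using assms M by (auto simp: \<epsilon>_def)
  obtain \<Lambda> where \<Lambda>: "\<Lambda> \<ge> 1"
    "\<And>g c. mono g \<Longrightarrow> 0 < c \<Longrightarrow> (\<And>j. j \<ge> 1 \<Longrightarrow> c \<le> g j \<and> g j \<le> real K * c * real j ^ N) \<Longrightarrow>
       \<exists>s. 1 \<le> s \<and> s \<le> \<Lambda> \<and> g (Suc s) \<le> (1 + \<epsilon>) * g s \<and> g (2 * s) \<le> 4 ^ (N + 1) * (g s :: real)"
    using growth_pigeonhole[OF \<epsilon>(1), where N = N and K = "real K"] by metis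
  \<comment> \<open>Secures \<open>4 * M * card Q \<le> p\<close> for every scale
    \<open>s \<le> \<Lambda>\<close>; \<open>K + 1\<close> keeps \<open>d\<close> positive when
    \<open>K = 0\<close>.\<close>
  define d where "d = 4 * M * (real K + 1) * real \<Lambda> ^ N"
  define \<alpha> where "\<alpha> = 1 / d"
  have d: "d > 0" using M \<Lambda>(1) by (simp add: d_def)
  show ?thesis
  proof
    show "\<alpha> > 0" using d by (simp add: \<alpha>_def)
    fix p and B :: "circle set"
    assume B: "finite B" "B \<noteq> {}" "B \<subseteq> roots p" "card (B + uminus ` B) \<le> K * card B" "real (card B) \<le> \<alpha> * real p"
    define n where "n = real (card B)"
    have n: "n > 0" using B by (simp add: n_def card_gt_0_iff)
    define g where "g = (\<lambda>j. real (card (nsum j B)))"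
    have "mono g" unfolding g_def using B by (intro monoI) (simp add: card_nsum_mono)
    moreover have gb: "n \<le> g j \<and> g j \<le> real K * n * real j ^ N" if "j \<ge> 1" for j
    proof
      show "n \<le> g j" using card_nsum_mono[OF B(1,2) that] by (simp add: n_def g_def)
      have "card (nsum (Suc (j - 1)) B) \<le> (j - 1 + 1) ^ N * (K * card B)"
        unfolding N_def by (rule card_nsum_polynomial[OF B(1,2,4)])
      then have "card (nsum j B) \<le> j ^ N * (K * card B)" using that by simp
      then have "real (card (nsum j B)) \<le> real (j ^ N * (K * card B))" using of_nat_le_iff by blast
      then show "g j \<le> real K * n * real j ^ N" by (simp add: g_def n_def ac_simps)
    qed
    ultimately obtain s where s: "1 \<le> s" "s \<le> \<Lambda>" "g (Suc s) \<le> (1 + \<epsilon>) * g s" "g (2 * s) \<le> M * g s"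
      using \<Lambda>(2)[of g n] n unfolding M_def by blast
    define Q where "Q = nsum s B"
    have Q: "finite Q" "Q \<noteq> {}" "Q \<subseteq> roots p"
      using B by (simp_all add: Q_def finite_nsum nsum_nonempty roots_nsum)
    have gQ: "g s = card Q" by (simp add: g_def Q_def)
    have cQ: "g s > 0" using gb[of s] n s by linarith
    have QQ: "real (card (Q + Q)) \<le> M * real (card Q)"
      using s(4) nsum_add[of s s B] by (simp add: g_def Q_def mult_2)
    have "real s ^ N \<le> real \<Lambda> ^ N" using s by (intro power_mono) auto
    then have "g s \<le> real K * n * real \<Lambda> ^ N"
      using gb[of s] s n by (smt (verit) mult_left_mono of_nat_0_le_iff mult_nonneg_nonneg)
    also have "\<dots> \<le> (real K + 1) * n * real \<Lambda> ^ N" using n by (intro mult_right_mono) auto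
    finally have "4 * M * g s \<le> 4 * M * ((real K + 1) * n * real \<Lambda> ^ N)" using M by simp
    also have "\<dots> = n * d" by (simp add: d_def)
    also have "\<dots> \<le> real p" using B(5) d by (simp add: \<alpha>_def n_def field_simps)
    finally have "4 * M * g s \<le> real p" .
    moreover have "M * g s > 0" using M cQ by simp
    ultimately have "2 * M * real (card Q) < real p" using gQ by simp
    then obtain t where t: "t \<in> {1..<p}" "(real (card Q))\<^sup>2 \<le> 2 * M * (cmod (\<Sum>q\<in>Q. cval q ^ t))\<^sup>2"
      using large_coefficient[OF Q QQ] by blast
    define F where "F = (\<Sum>q\<in>Q. cval q ^ t)"
    \<comment> \<open>Both translates lie in \<open>nsum (Suc s) B\<close>, which is at most
      \<open>1 + \<epsilon>\<close> times as large as \<open>Q\<close>.\<close>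
    have diff: "real (card ((+) b ` Q - (+) c ` Q)) \<le> \<epsilon> * g s" if "b \<in> B" "c \<in> B" for b c
    proof -
      have "(+) b ` Q \<union> (+) c ` Q \<subseteq> nsum (Suc s) B" using that by (auto simp: Q_def)
      then have "card ((+) b ` Q \<union> (+) c ` Q) \<le> card (nsum (Suc s) B)"
        using B by (intro card_mono finite_nsum) auto
      moreover have "card ((+) b ` Q \<union> (+) c ` Q) = card ((+) b ` Q - (+) c ` Q) + card Q"
        using card_Un_disjoint[of "(+) b ` Q - (+) c ` Q" "(+) c ` Q"] Q
        by (simp add: Un_Diff_cancel2 Diff_Int_distrib2)
      ultimately have "real (card ((+) b ` Q - (+) c ` Q)) + g s \<le> g (Suc s)"
        by (simp add: g_def Q_def del: nsum.simps flip: of_nat_add)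
      then show ?thesis using s(3) by (simp add: algebra_simps)
    qed
    have "(cmod (cval b ^ t - cval c ^ t))\<^sup>2 \<le> \<delta>" if bc: "b \<in> B" "c \<in> B" for b c
    proof -
      let ?f = "\<lambda>q. cval q ^ t"
      have tr: "(\<Sum>q\<in>(+) x ` Q. ?f q) = cval x ^ t * F" for x
        by (simp add: sum.reindex F_def sum_distrib_left power_mult_distrib)
      have fin: "finite ((+) x ` Q)" for x using Q by simp
      \<comment> \<open>In the difference of the two sums the common part of the translates cancels;
        only the two small set differences remain.\<close>
      have "(cval b ^ t - cval c ^ t) * F = (\<Sum>q\<in>(+) b ` Q. ?f q) - (\<Sum>q\<in>(+) c ` Q. ?f q)"
        by (simp add: tr left_diff_distrib)
      moreover have "(\<Sum>q\<in>(+) b ` Q. ?f q) = (\<Sum>q\<in>(+) b ` Q \<inter> (+) c ` Q. ?f q) + (\<Sum>q\<in>(+) b ` Q - (+) c ` Q. ?f q)"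
        by (rule sum.Int_Diff[OF fin])
      moreover have "(\<Sum>q\<in>(+) c ` Q. ?f q) = (\<Sum>q\<in>(+) b ` Q \<inter> (+) c ` Q. ?f q) + (\<Sum>q\<in>(+) c ` Q - (+) b ` Q. ?f q)"
        unfolding Int_commute[of "(+) b ` Q"] by (rule sum.Int_Diff[OF fin])
      ultimately have eq: "(cval b ^ t - cval c ^ t) * F = (\<Sum>q\<in>(+) b ` Q - (+) c ` Q. ?f q) - (\<Sum>q\<in>(+) c ` Q - (+) b ` Q. ?f q)"
        by simp
      have nrm: "cmod (\<Sum>q\<in>S. ?f q) \<le> real (card S)" for S
        using norm_sum[of ?f S] by (simp add: norm_power)
      have "cmod (cval b ^ t - cval c ^ t) * cmod F
          = cmod ((\<Sum>q\<in>(+) b ` Q - (+) c ` Q. ?f q) - (\<Sum>q\<in>(+) c ` Q - (+) b ` Q. ?f q))"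
        by (simp only: eq norm_mult[symmetric])
      also have "\<dots> \<le> cmod (\<Sum>q\<in>(+) b ` Q - (+) c ` Q. ?f q) + cmod (\<Sum>q\<in>(+) c ` Q - (+) b ` Q. ?f q)"
        by (rule norm_triangle_ineq4)
      also have "\<dots> \<le> 2 * (\<epsilon> * g s)"
        using nrm[of "(+) b ` Q - (+) c ` Q"] nrm[of "(+) c ` Q - (+) b ` Q"] diff[OF bc] diff[OF bc(2,1)]
        by linarith
      finally have "cmod (cval b ^ t - cval c ^ t) * cmod F \<le> 2 * (\<epsilon> * g s)" .
      then have "(cmod (cval b ^ t - cval c ^ t) * cmod F)\<^sup>2 \<le> (2 * (\<epsilon> * g s))\<^sup>2"
        by (intro power_mono) auto
      then have 1: "(cmod (cval b ^ t - cval c ^ t))\<^sup>2 * (cmod F)\<^sup>2 \<le> 4 * \<epsilon>\<^sup>2 * (g s)\<^sup>2"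
        by (simp add: power_mult_distrib)
      have "(cmod (cval b ^ t - cval c ^ t))\<^sup>2 * (g s)\<^sup>2 \<le> (cmod (cval b ^ t - cval c ^ t))\<^sup>2 * (2 * M * (cmod F)\<^sup>2)"
        using t(2) unfolding F_def gQ by (intro mult_left_mono) auto
      also have "\<dots> \<le> 2 * M * (4 * \<epsilon>\<^sup>2 * (g s)\<^sup>2)"
        using mult_left_mono[OF 1, of "2 * M"] M by (simp add: ac_simps)
      also have "\<dots> = \<delta> * (g s)\<^sup>2" unfolding \<epsilon>(2)[symmetric] by simp
      finally show ?thesis using cQ by simp
    qed
    then show "\<exists>t\<in>{1..<p}. \<forall>b\<in>B. \<forall>c\<in>B. (cmod (cval b ^ t - cval c ^ t))\<^sup>2 \<le> \<delta>" using t(1) by blast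
  qed
qed

section \<open>Cyclic groups of prime order\<close>

text \<open>\<open>\<phi>\<close> identifies the integers modulo \<open>p\<close> with its range.
  Integer arguments give a meaning to intervals and windows, and a dilation of the integers yields
  another instance on the same group.\<close>

locale cyclic_cover =
  fixes \<phi> :: "int \<Rightarrow> 'a::ab_group_add" and p :: nat
  assumes prime: "prime p"
    and hom: "\<phi> (x + y) = \<phi> x + \<phi> y"
    and ker: "\<phi> x = 0 \<longleftrightarrow> int p dvd x"
begin

lemma p_pos: "p > 0"
  using prime prime_gt_0_nat by blast

lemma phi_0 [simp]: "\<phi> 0 = 0"
  by (simp add: ker)

lemma phi_uminus: "\<phi> (- x) = - \<phi> x"
  by (metis add.right_inverse hom minus_unique phi_0)

lemma phi_diff: "\<phi> (x - y) = \<phi> x - \<phi> y"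
  by (metis hom phi_uminus add_uminus_conv_diff)

lemma phi_eq_iff: "\<phi> x = \<phi> y \<longleftrightarrow> int p dvd x - y"
  by (metis ker phi_diff right_minus_eq)

lemma phi_mod [simp]: "\<phi> (x mod int p) = \<phi> x"
  by (metis phi_eq_iff dvd_minus_mod dvd_minus_iff minus_diff_eq)

lemma inj_on_phi: "L \<le> int p \<Longrightarrow> inj_on \<phi> {x..<x + L}"
proof (rule inj_onI)
  fix y z assume L: "L \<le> int p" and y: "y \<in> {x..<x + L}" "z \<in> {x..<x + L}" "\<phi> y = \<phi> z"
  then have "int p dvd y - z" by (simp add: phi_eq_iff)
  moreover have "\<bar>y - z\<bar> < int p" using y L by auto
  ultimately show "y = z" by (metis dvd_imp_le_int eq_iff_diff_eq_0 not_less abs_of_nat)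
qed

text \<open>The set contains all \<open>s + k * d\<close> with \<open>k < p\<close>, and these are
  distinct because \<open>p\<close> is prime. This supplies the hypothesis of
  \<open>cauchy_davenport\<close>.\<close>

lemma card_translation_closed:
  assumes "finite S" "S \<noteq> {}" "d \<in> range \<phi>" "d \<noteq> 0" "(+) d ` S \<subseteq> S"
  shows "p \<le> card S"
proof -
  obtain u where u: "d = \<phi> u" using assms by blast
  then have nd: "\<not> int p dvd u" using assms ker by blast
  obtain s where s: "s \<in> S" using assms by blast
  have S: "\<phi> (int k * u) + s \<in> S" for k
  proof (induction k)
    case (Suc k)
    have "\<phi> (int (Suc k) * u) + s = d + (\<phi> (int k * u) + s)"
      by (simp add: algebra_simps hom u)
    then show ?case using Suc assms(5) by auto
  qed (use s in simp)
  have "inj_on (\<lambda>k. \<phi> (int k * u) + s) {..<p}"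
  proof (rule inj_onI)
    fix k l assume kl: "k \<in> {..<p}" "l \<in> {..<p}" "\<phi> (int k * u) + s = \<phi> (int l * u) + s"
    then have "int p dvd (int k - int l) * u" by (simp add: phi_eq_iff left_diff_distrib)
    then have "int p dvd int k - int l"
      using nd prime by (metis prime_dvd_multD prime_nat_int_transfer)
    moreover have "\<bar>int k - int l\<bar> < int p" using kl by auto
    ultimately show "k = l" by (metis dvd_imp_le_int eq_iff_diff_eq_0 not_less abs_of_nat of_nat_eq_iff)
  qed
  then show ?thesis using card_inj_on_le[of _ "{..<p}" S] S assms by auto
qed

section \<open>Counting in windows\<close>

text \<open>Integers are counted, not group elements: a window longer than \<open>p\<close> meets
  elements of \<open>S\<close> repeatedly.\<close>

definition cnt :: "'a set \<Rightarrow> int \<Rightarrow> int \<Rightarrow> int" where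
  "cnt S x L = int (card ({x..<x + L} \<inter> \<phi> -` S))"

lemma cnt_nonneg: "cnt S x L \<ge> 0"
  by (simp add: cnt_def)

lemma cnt_mono: "S \<subseteq> S' \<Longrightarrow> x' \<le> x \<Longrightarrow> x + L \<le> x' + L' \<Longrightarrow> cnt S x L \<le> cnt S' x' L'"
  unfolding cnt_def by (intro of_nat_mono card_mono) auto

lemma cnt_split:
  assumes "0 \<le> L" "0 \<le> L'"
  shows "cnt S x (L + L') = cnt S x L + cnt S (x + L) L'"
proof -
  have "({x..<x + (L + L')} \<inter> \<phi> -` S)
      = ({x..<x + L} \<inter> \<phi> -` S) \<union> ({x + L..<x + L + L'} \<inter> \<phi> -` S)"
    using assms by auto
  also have "card \<dots> = card ({x..<x + L} \<inter> \<phi> -` S) + card ({x + L..<x + L + L'} \<inter> \<phi> -` S)"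
    by (intro card_Un_disjoint) auto
  finally show ?thesis by (simp add: cnt_def)
qed

lemma cnt_le_card: "finite S \<Longrightarrow> L \<le> int p \<Longrightarrow> cnt S x L \<le> int (card S)"
  unfolding cnt_def of_nat_le_iff
  by (intro card_inj_on_le[of \<phi>] inj_on_subset[OF inj_on_phi[of L x]]) auto

lemma cnt_shift: "cnt S (x + d) L = cnt {u. \<phi> d + u \<in> S} x L"
proof -
  have "bij_betw (\<lambda>y. y - d) ({x + d..<x + d + L} \<inter> \<phi> -` S) ({x..<x + L} \<inter> \<phi> -` {u. \<phi> d + u \<in> S})"
    by (rule bij_betw_byWitness[where f' = "\<lambda>y. y + d"]) (auto simp: hom phi_diff add.commute)
  then show ?thesis unfolding cnt_def by (metis bij_betw_same_card)
qed

lemma cnt_cong: "\<phi> x = \<phi> y \<Longrightarrow> cnt S x L = cnt S y L"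
  using cnt_shift[of S y "x - y" L] by (simp add: phi_diff)

lemma cnt_full:
  assumes "finite S" "S \<subseteq> range \<phi>"
  shows "cnt S x (int p) = int (card S)"
proof -
  have "\<phi> ` ({x..<x + int p} \<inter> \<phi> -` S) = S"
  proof
    show "S \<subseteq> \<phi> ` ({x..<x + int p} \<inter> \<phi> -` S)"
    proof
      fix s assume s: "s \<in> S"
      then obtain u where u: "s = \<phi> u" using assms by blast
      have "\<phi> (x + (u - x) mod int p) = \<phi> u" by (simp add: hom phi_diff)
      moreover have "x + (u - x) mod int p \<in> {x..<x + int p}" using p_pos by simp
      ultimately show "s \<in> \<phi> ` ({x..<x + int p} \<inter> \<phi> -` S)" using s u by (intro image_eqI[of _ _ "x + (u - x) mod int p"]) (auto simp del: atLeastLessThan_iff)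
    qed
  qed auto
  moreover have "inj_on \<phi> ({x..<x + int p} \<inter> \<phi> -` S)"
    by (rule inj_on_subset[OF inj_on_phi[of "int p" x]]) auto
  ultimately show ?thesis by (metis card_image cnt_def)
qed

lemma cnt_eq_sum: "cnt S x L = (\<Sum>l\<in>{0..<L}. of_bool (\<phi> (x + l) \<in> S))"
proof -
  have "bij_betw (\<lambda>y. y - x) ({x..<x + L} \<inter> \<phi> -` S) {l \<in> {0..<L}. \<phi> (x + l) \<in> S}"
    by (rule bij_betw_byWitness[where f' = "\<lambda>y. x + y"]) auto
  then have "cnt S x L = int (card {l \<in> {0..<L}. \<phi> (x + l) \<in> S})"
    unfolding cnt_def by (metis bij_betw_same_card)
  then show ?thesis by (simp add: Int_def)
qed

text \<open>As the window slides through one full period, each of its \<open>L\<close> positions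
  passes every element of \<open>S\<close> exactly once.\<close>

lemma sum_cnt:
  assumes "finite S" "S \<subseteq> range \<phi>" "0 \<le> L"
  shows "(\<Sum>x\<in>{0..<int p}. cnt S (x + c) L) = L * int (card S)"
proof -
  have "(\<Sum>x\<in>{0..<int p}. cnt S (x + c) L) = (\<Sum>l\<in>{0..<L}. \<Sum>x\<in>{0..<int p}. of_bool (\<phi> (c + l + x) \<in> S))"
    unfolding cnt_eq_sum by (subst sum.swap) (simp add: ac_simps)
  also have "\<dots> = (\<Sum>l\<in>{0..<L}. cnt S (c + l) (int p))" by (simp add: cnt_eq_sum)
  also have "\<dots> = L * int (card S)" using assms by (simp add: cnt_full)
  finally show ?thesis .
qed

text \<open>
  \<open>N x\<close> counts \<open>D\<close> in the window \<open>[x, x + m)\<close>.  Passing from \<open>x\<close> to \<open>x + m\<close>, it grows by at most the number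
  of runs starting in between, so \<open>N x \<le> R + w\<close> for the count \<open>w\<close> of \<open>D\<close> in the sparsest window of length
  \<open>2 m\<close>.  Failure for all third elements forces the average of \<open>N\<close> over \<open>A\<close> to be at least
  \<open>R + 1\<close>.  But most windows are sparse and contain at least \<open>w\<close> elements of \<open>D\<close>, hence so many
  \<open>x \<in> A\<close> have \<open>N x \<le> R / 2\<close> that the average stays below \<open>R\<close>.
\<close>

lemma three_translates_of_interval:
  fixes A :: "'a set" and J :: "int set" and n :: nat and m :: int
  assumes A: "finite A" "A \<subseteq> range \<phi>" "card A = n"
    and J: "J \<subseteq> {0..m}" "0 \<in> J" "m \<in> J" "card J = n"
    and m: "0 < m" "400 * m \<le> int p"
  shows "\<exists>i\<in>J. \<exists>j\<in>J. \<exists>k\<in>J. card (A + {\<phi> i, \<phi> j, \<phi> k}) \<ge> 2 * n - 1"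
proof (rule ccontr)
  assume neg: "\<not> ?thesis"
  have fJ: "finite J" using J finite_subset by auto
  have n2: "n \<ge> 2" using card_mono[of J "{0, m}"] J m fJ by simp
  have triple: "card (A + {\<phi> i, \<phi> j, \<phi> k}) \<le> 2 * n - 2" if "i \<in> J" "j \<in> J" "k \<in> J" for i j k
  proof -
    have "\<not> 2 * n - 1 \<le> card (A + {\<phi> i, \<phi> j, \<phi> k})" using neg that by blast
    then show ?thesis by linarith
  qed
  define D where "D = A \<union> (+) (\<phi> m) ` A"
  \<comment> \<open>The first elements of the runs of \<open>A\<close> with difference
    \<open>m\<close>; \<open>D\<close> is the disjoint union of \<open>E\<close> and
    \<open>m + A\<close>, so \<open>R\<close> counts runs.\<close>
  define E where "E = A - (+) (\<phi> m) ` A"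
  define R where "R = int (card D) - int n"
  have fin: "finite D" "finite E" using A by (auto simp: D_def E_def)
  have Dr: "D \<subseteq> range \<phi>"
  proof
    fix d assume "d \<in> D"
    then obtain a where a: "a \<in> A" "d = a \<or> d = \<phi> m + a" by (auto simp: D_def)
    then obtain u where "a = \<phi> u" using A by blast
    then have "d = \<phi> u \<or> d = \<phi> (m + u)" using a hom by auto
    then show "d \<in> range \<phi>" by blast
  qed
  have Er: "int (card E) = R"
  proof -
    have "card D = card E + card ((+) (\<phi> m) ` A)"
      using card_Un_disjoint[of E "(+) (\<phi> m) ` A"] A fin by (auto simp: D_def E_def)
    then show ?thesis using A by (simp add: R_def)
  qed
  have R0: "R \<ge> 0" using Er by simp
  have DA: "A + {\<phi> 0, \<phi> m, \<phi> b} = D \<union> (+) (\<phi> b) ` A" for b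
    by (auto simp: D_def set_plus_def add.commute image_iff)
  have Rn: "R \<le> int n - 2"
  proof -
    have "card (D \<union> (+) (\<phi> 0) ` A) \<le> 2 * n - 2" using triple[of 0 m 0] J by (simp only: DA)
    moreover have "D \<union> (+) (\<phi> 0) ` A = D" by (auto simp: D_def)
    ultimately show ?thesis using n2 by (simp add: R_def)
  qed
  \<comment> \<open>Inclusion--exclusion for the triple \<open>0\<close>, \<open>m\<close>,
    \<open>b\<close>, using \<open>card D = n + R\<close>.\<close>
  have big: "int (card (D \<inter> (+) (\<phi> b) ` A)) \<ge> R + 2" if "b \<in> J" for b
  proof -
    have "card (D \<union> (+) (\<phi> b) ` A) \<le> 2 * n - 2" using triple[of 0 m b] J that by (simp only: DA)
    moreover have "card D + card ((+) (\<phi> b) ` A) = card (D \<union> (+) (\<phi> b) ` A) + card (D \<inter> (+) (\<phi> b) ` A)"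
      using A fin by (intro card_Un_Int) auto
    ultimately show ?thesis using n2 A by (simp add: R_def)
  qed
  define X where "X = {0..<int p} \<inter> \<phi> -` A"
  have fX: "finite X" by (simp add: X_def)
  have cX: "int (card X) = n" using cnt_full[OF A(1,2), of 0] A(3) by (simp add: cnt_def X_def)
  have transl: "card (S \<inter> (+) (\<phi> b) ` A) = (\<Sum>x\<in>X. of_bool (\<phi> (x + b) \<in> S))" for S b
  proof -
    have "bij_betw (\<lambda>x. \<phi> (x + b)) {x \<in> X. \<phi> (x + b) \<in> S} (S \<inter> (+) (\<phi> b) ` A)"
      unfolding bij_betw_def
    proof
      show "inj_on (\<lambda>x. \<phi> (x + b)) {x \<in> X. \<phi> (x + b) \<in> S}"
        using inj_on_phi[of "int p" 0] by (auto simp: inj_on_def hom X_def)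
      show "(\<lambda>x. \<phi> (x + b)) ` {x \<in> X. \<phi> (x + b) \<in> S} = S \<inter> (+) (\<phi> b) ` A"
      proof
        show "S \<inter> (+) (\<phi> b) ` A \<subseteq> (\<lambda>x. \<phi> (x + b)) ` {x \<in> X. \<phi> (x + b) \<in> S}"
        proof
          fix s assume s: "s \<in> S \<inter> (+) (\<phi> b) ` A"
          then obtain u where u: "\<phi> u \<in> A" "s = \<phi> b + \<phi> u" using A by blast
          then have "u mod int p \<in> X" "s = \<phi> (u mod int p + b)"
            using p_pos by (auto simp: X_def hom add.commute)
          then show "s \<in> (\<lambda>x. \<phi> (x + b)) ` {x \<in> X. \<phi> (x + b) \<in> S}" using s by blast
        qed
      qed (auto simp: X_def hom add.commute)
    qed
    then have "card {x \<in> X. \<phi> (x + b) \<in> S} = card (S \<inter> (+) (\<phi> b) ` A)" by (rule bij_betw_same_card)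
    then show ?thesis using fX by (simp add: Int_def)
  qed
  define N where "N = (\<lambda>x. cnt D x m)"
  \<comment> \<open>Sum \<open>big\<close> over \<open>b\<close>. Leaving out \<open>m\<close> keeps
    \<open>b\<close> in a window of length exactly \<open>m\<close>, and
    \<open>R \<le> n - 2\<close> makes up for the lost term.\<close>
  have lower: "int n * R + int n \<le> (\<Sum>x\<in>X. N x)"
  proof -
    have "(int n - 1) * (R + 2) = (\<Sum>b\<in>J - {m}. R + 2)"
      using J fJ n2 by (simp add: of_nat_diff)
    also have "\<dots> \<le> (\<Sum>b\<in>J - {m}. int (card (D \<inter> (+) (\<phi> b) ` A)))" using big by (intro sum_mono) auto
    also have "\<dots> = (\<Sum>x\<in>X. \<Sum>b\<in>J - {m}. of_bool (\<phi> (x + b) \<in> D))"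
      by (subst sum.swap) (simp add: transl)
    also have "\<dots> \<le> (\<Sum>x\<in>X. N x)"
    proof (intro sum_mono)
      fix x
      have "(\<Sum>b\<in>J - {m}. of_bool (\<phi> (x + b) \<in> D)) \<le> (\<Sum>b\<in>{0..<m}. (of_bool (\<phi> (x + b) \<in> D) :: int))"
        using J by (intro sum_mono2) force+
      then show "(\<Sum>b\<in>J - {m}. of_bool (\<phi> (x + b) \<in> D)) \<le> N x" by (simp add: N_def cnt_eq_sum)
    qed
    finally show ?thesis using Rn by (simp add: algebra_simps)
  qed
  \<comment> \<open>An element of \<open>D\<close> in the later window either has its predecessor by
    \<open>m\<close> in \<open>D\<close>, or starts a run.\<close>
  have step: "N (x + m) \<le> N x + cnt E (x + m) m" for x
  proof -
    have "({x + m..<x + m + m} \<inter> \<phi> -` D)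
        \<subseteq> (\<lambda>y. y + m) ` ({x..<x + m} \<inter> \<phi> -` D) \<union> ({x + m..<x + m + m} \<inter> \<phi> -` E)"
    proof
      fix y assume y: "y \<in> ({x + m..<x + m + m} \<inter> \<phi> -` D)"
      show "y \<in> (\<lambda>y. y + m) ` ({x..<x + m} \<inter> \<phi> -` D) \<union> ({x + m..<x + m + m} \<inter> \<phi> -` E)"
      proof (cases "\<phi> (y - m) \<in> D")
        case True
        then have "y - m \<in> ({x..<x + m} \<inter> \<phi> -` D)" using y by auto
        then show ?thesis by (metis UnI1 diff_add_cancel image_eqI)
      next
        case False
        have "\<phi> y \<notin> (+) (\<phi> m) ` A"
        proof
          assume "\<phi> y \<in> (+) (\<phi> m) ` A"
          then have "\<phi> (y - m) \<in> A" by (auto simp: phi_diff)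
          then show False using False by (simp add: D_def)
        qed
        then have "\<phi> y \<in> E" using y by (auto simp: D_def E_def)
        then show ?thesis using y by blast
      qed
    qed
    then have "card ({x + m..<x + m + m} \<inter> \<phi> -` D)
        \<le> card ((\<lambda>y. y + m) ` ({x..<x + m} \<inter> \<phi> -` D) \<union> ({x + m..<x + m + m} \<inter> \<phi> -` E))"
      by (intro card_mono) auto
    also have "\<dots> \<le> card ({x..<x + m} \<inter> \<phi> -` D) + card ({x + m..<x + m + m} \<inter> \<phi> -` E)"
      by (intro order_trans[OF card_Un_le] add_right_mono card_image_le) auto
    finally show ?thesis by (simp add: N_def cnt_def)
  qed
  have iter: "N (x + int q * m) \<le> N x + cnt E (x + m) (int q * m)" for x q
  proof (induction q)
    case 0
    show ?case by (simp add: cnt_nonneg)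
  next
    case (Suc q)
    have "N (x + int (Suc q) * m) \<le> N (x + int q * m) + cnt E (x + int q * m + m) m"
      using step[of "x + int q * m"] by (simp add: algebra_simps)
    moreover have "cnt E (x + m) (int q * m + m) = cnt E (x + m) (int q * m) + cnt E (x + m + int q * m) m"
      using m by (intro cnt_split) auto
    ultimately show ?case using Suc by (simp add: algebra_simps)
  qed
  \<comment> \<open>Modulo \<open>p\<close>, \<open>x\<close> is reached by steps of
    \<open>m\<close> from \<open>z + r\<close>, whose window lies in \<open>[z, z + 2 * m)\<close>.
    The steps cover less than one period, so each run start is counted at most once.\<close>
  have upper: "N x \<le> R + cnt D z (2 * m)" for x z
  proof -
    define y where "y = (x - z) mod int p"
    have y: "0 \<le> y" "y < int p" using p_pos by (auto simp: y_def)
    define q where "q = nat (y div m)"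
    define r where "r = y mod m"
    have r: "0 \<le> r" "r < m" using m by (auto simp: r_def)
    have yqr: "y = int q * m + r" using y m by (simp add: q_def r_def pos_imp_zdiv_nonneg_iff)
    have "N x = N (z + y)" unfolding N_def by (intro cnt_cong) (simp add: y_def hom phi_diff)
    also have "\<dots> = N (z + r + int q * m)" by (simp add: yqr ac_simps)
    also have "\<dots> \<le> N (z + r) + cnt E (z + r + m) (int q * m)" by (rule iter)
    also have "cnt E (z + r + m) (int q * m) \<le> R"
      using cnt_le_card[of E "int q * m" "z + r + m"] fin Er y yqr r by auto
    also have "N (z + r) \<le> cnt D z (2 * m)" unfolding N_def using r by (intro cnt_mono) auto
    finally show ?thesis by simp
  qed
  have cD: "int (card D) \<le> 2 * int n" using Rn by (simp add: R_def)
  obtain z where z: "\<And>x. cnt D z (2 * m) \<le> cnt D x (2 * m)"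
  proof -
    have "\<exists>z. \<forall>x. nat (cnt D z (2 * m)) \<le> nat (cnt D x (2 * m))" using ex_has_least_nat[of "\<lambda>_. True" _ "\<lambda>z. nat (cnt D z (2 * m))"] by auto
    then show ?thesis using that by (metis cnt_nonneg nat_le_eq_zle order.trans nat_mono eq_nat_nat_iff le_cases)
  qed
  define w where "w = cnt D z (2 * m)"
  have w0: "w \<ge> 0" by (simp add: w_def cnt_nonneg)
  have Nw: "N x \<le> R + w" for x using upper[of x z] by (simp add: w_def)
  \<comment> \<open>The sparsest window holds at most the average over all windows of length
    \<open>2 * m\<close>.\<close>
  have pw: "int p * w \<le> 4 * m * int n"
  proof -
    have "int p * w = (\<Sum>x\<in>{0..<int p}. w)" by simp
    also have "\<dots> \<le> (\<Sum>x\<in>{0..<int p}. cnt D (x + 0) (2 * m))" using z by (intro sum_mono) (simp add: w_def)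
    also have "\<dots> = 2 * m * int (card D)" using fin Dr m by (intro sum_cnt) auto
    also have "\<dots> \<le> 2 * m * (2 * int n)" using cD m by (intro mult_left_mono) auto
    finally show ?thesis by simp
  qed
  have w_small: "100 * w \<le> int n"
  proof -
    have "400 * m * w \<le> int p * w" using m w0 by (intro mult_right_mono) auto
    then have "m * (400 * w) \<le> m * (4 * int n)" using pw by (simp add: ac_simps)
    then show ?thesis using m by simp
  qed
  \<comment> \<open>For fixed \<open>y\<close> at most \<open>h\<close> elements \<open>b\<close> of
    \<open>J\<close> have \<open>\<phi> (y - b) \<in> A\<close>. Averaging gives \<open>c\<close>
    with small overlap of \<open>A\<close> and its translate by \<open>\<phi> c\<close>; Bonferroni
    for \<open>0\<close>, \<open>c\<close>, \<open>b\<close>, summed over \<open>b\<close>, then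
    forces \<open>n + 2 \<le> 3 * h\<close>.\<close>
  have R_large: "8 * R \<ge> int n"
  proof -
    \<comment> \<open>The \<open>+ 1\<close> pays for an endpoint: \<open>J\<close> lies among
      \<open>m + 1\<close> integers, while \<open>N\<close> counts in windows of length
      \<open>m\<close>.\<close>
    define h where "h = R + w + 1"
    have mult: "(\<Sum>b\<in>J. of_bool (\<phi> (y - b) \<in> A)) \<le> h" for y
    proof -
      have "(\<Sum>b\<in>J. of_bool (\<phi> (y - b) \<in> A)) = int (card {b \<in> J. \<phi> (y - b) \<in> A})"
        using fJ by (simp add: Int_def)
      also have "\<dots> \<le> cnt A (y - m) (m + 1)"
        unfolding cnt_def of_nat_le_iff
        using J by (intro card_inj_on_le[of "\<lambda>b. y - b"]) (auto simp: inj_on_def)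
      also have "\<dots> = cnt A (y - m) m + cnt A y 1" using m by (subst cnt_split) auto
      also have "cnt A y 1 \<le> 1"
      proof -
        have "{y..<y + 1} = {y}" by auto
        then show ?thesis by (simp add: cnt_def card_le_Suc0_iff_eq)
      qed
      also have "cnt A (y - m) m \<le> N (y - m)" unfolding N_def by (intro cnt_mono) (auto simp: D_def)
      finally show ?thesis using Nw[of "y - m"] by (simp add: h_def)
    qed
    have pairs: "(\<Sum>b\<in>J. int (card ((+) (\<phi> c) ` A \<inter> (+) (\<phi> b) ` A))) \<le> int n * h" for c
    proof -
      have swap: "card ((+) (\<phi> c) ` A \<inter> (+) (\<phi> b) ` A) = (\<Sum>x\<in>X. of_bool (\<phi> (x + c - b) \<in> A))" for b
      proof -
        have "(\<phi> (x + c) \<in> (+) (\<phi> b) ` A) = (\<phi> (x + c - b) \<in> A)" for x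
          by (auto simp: phi_diff image_iff intro!: bexI[of _ "\<phi> (x + c) - \<phi> b"])
        then show ?thesis using transl[of "(+) (\<phi> b) ` A" c] by (simp add: Int_commute)
      qed
      have "(\<Sum>b\<in>J. int (card ((+) (\<phi> c) ` A \<inter> (+) (\<phi> b) ` A))) = (\<Sum>x\<in>X. \<Sum>b\<in>J. of_bool (\<phi> (x + c - b) \<in> A))"
        by (subst sum.swap) (simp add: swap)
      also have "\<dots> \<le> (\<Sum>x\<in>X. h)" by (intro sum_mono mult)
      finally show ?thesis using cX by simp
    qed
    let ?i = "\<lambda>b c. int (card ((+) (\<phi> b) ` A \<inter> (+) (\<phi> c) ` A))"
    have "\<exists>c\<in>J. ?i 0 c \<le> h"
    proof (rule ccontr)
      assume "\<not> (\<exists>c\<in>J. ?i 0 c \<le> h)"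
      then have "h < ?i 0 b" if "b \<in> J" for b using that by force
      then have "(\<Sum>b\<in>J. h) < (\<Sum>b\<in>J. ?i 0 b)" using J fJ by (intro sum_strict_mono) auto
      then show False using pairs[of 0] J by simp
    qed
    then obtain c where c: "c \<in> J" "?i 0 c \<le> h" by blast
    have "int n + 2 \<le> ?i 0 c + ?i 0 b + ?i c b" if b: "b \<in> J" for b
    proof -
      let ?T = "\<lambda>b. (+) (\<phi> b) ` A"
      have "A + {\<phi> 0, \<phi> c, \<phi> b} = ?T 0 \<union> ?T c \<union> ?T b" by (auto simp: set_plus_def add.commute image_iff)
      then have 1: "card (?T 0 \<union> ?T c \<union> ?T b) \<le> 2 * n - 2" using triple[of 0 c b] J b c by simp
      have 2: "card (?T 0) + card (?T c) = card (?T 0 \<union> ?T c) + card (?T 0 \<inter> ?T c)"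
        using A by (intro card_Un_Int) auto
      have 3: "card (?T 0 \<union> ?T c) + card (?T b) = card (?T 0 \<union> ?T c \<union> ?T b) + card ((?T 0 \<union> ?T c) \<inter> ?T b)"
        using A by (intro card_Un_Int) auto
      have 4: "card ((?T 0 \<union> ?T c) \<inter> ?T b) \<le> card (?T 0 \<inter> ?T b) + card (?T c \<inter> ?T b)"
        unfolding Int_Un_distrib2 by (rule card_Un_le)
      have c3: "card (?T x) = n" for x using A by simp
      show ?thesis using 1 2 3 4 n2 unfolding c3 by linarith
    qed
    then have "(\<Sum>b\<in>J. int n + 2) \<le> (\<Sum>b\<in>J. ?i 0 c + ?i 0 b + ?i c b)" by (intro sum_mono)
    also have "\<dots> = int n * ?i 0 c + (\<Sum>b\<in>J. ?i 0 b) + (\<Sum>b\<in>J. ?i c b)"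
      using J by (simp add: sum.distrib)
    also have "\<dots> \<le> int n * h + int n * h + int n * h"
      using pairs[of 0] pairs[of c] c(2) by (intro add_mono mult_left_mono) auto
    finally have "int n * (int n + 2) \<le> int n * (3 * h)" using J by (simp add: algebra_simps)
    then have "int n + 2 \<le> 3 * h" using n2 by simp
    then show ?thesis using w_small n2 by (simp add: h_def)
  qed
  have R_pos: "R > 0" using R_large n2 by linarith
  \<comment> \<open>The light elements of \<open>A\<close>, whose window holds at most
    \<open>R / 2\<close> elements of \<open>D\<close>. As \<open>N x\<close> depends only on
    \<open>\<phi> x\<close>, any lift may be used to test this.\<close>
  define Al where "Al = A \<inter> \<phi> ` {x. 2 * N x \<le> R}"
  define Xl where "Xl = {x \<in> X. 2 * N x \<le> R}"
  have light_iff: "\<phi> x \<in> Al \<longleftrightarrow> \<phi> x \<in> A \<and> 2 * N x \<le> R" for x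
  proof -
    have "N x = N y" if "\<phi> x = \<phi> y" for y unfolding N_def using that by (rule cnt_cong)
    then show ?thesis unfolding Al_def by (metis (mono_tags, lifting) IntE IntI imageE imageI mem_Collect_eq)
  qed
  have Al: "finite Al" "Al \<subseteq> range \<phi>" using A by (auto simp: Al_def)
  have cXl: "int (card Xl) = int (card Al)"
  proof -
    have "Xl = {0..<int p} \<inter> \<phi> -` Al" by (auto simp: Xl_def X_def light_iff)
    then show ?thesis using cnt_full[OF Al, of 0] by (simp add: cnt_def)
  qed
  \<comment> \<open>By \<open>lower\<close> the average of \<open>N\<close> over \<open>X\<close> is
    at least \<open>R + 1\<close>. Always \<open>N \<le> R + w\<close>, and a light element falls at
    least \<open>R / 2\<close> below this bound; with \<open>n \<le> 8 * R\<close> there are fewer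
    than \<open>16 * w\<close> of them.\<close>
  have light_few: "int (card Al) < 16 * w"
  proof -
    have "2 * (int n * R + int n) \<le> (\<Sum>x\<in>X. 2 * N x)" using lower by (simp flip: sum_distrib_left)
    also have "\<dots> \<le> (\<Sum>x\<in>X. 2 * (R + w) - (if x \<in> Xl then R else 0))"
    proof (intro sum_mono)
      fix x
      show "2 * N x \<le> 2 * (R + w) - (if x \<in> Xl then R else 0)"
        using Nw[of x] w0 by (auto simp: Xl_def)
    qed
    also have "\<dots> = 2 * int n * (R + w) - (\<Sum>x\<in>X. if x \<in> Xl then R else 0)"
      using cX by (simp add: sum_subtractf)
    also have "(\<Sum>x\<in>X. if x \<in> Xl then R else 0) = (\<Sum>x\<in>Xl. R)"
      using fX by (intro sum.mono_neutral_cong_right) (auto simp: Xl_def)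
    also have "\<dots> = int (card Al) * R" using cXl by simp
    finally have "int (card Al) * R + 2 * int n \<le> 2 * int n * w" by (simp add: algebra_simps)
    also have "2 * int n * w \<le> 2 * (8 * R) * w" using R_large w0 by (intro mult_right_mono) auto
    finally have "int (card Al) * R < 16 * w * R" using n2 by (simp add: algebra_simps)
    then show ?thesis using R_pos by simp
  qed
  \<comment> \<open>Either the window of length \<open>4 * m\<close> holds more than
    \<open>R / 2\<close> elements of \<open>D\<close>, or all elements of \<open>A\<close> in its
    initial part of length \<open>3 * m\<close> are light. In the second case they number at least
    \<open>w / 2\<close>, because \<open>D\<close> consists of two translates of \<open>A\<close>.
    Scaling by \<open>w * R\<close> merges both cases into one inequality fit for averaging.\<close>
  have ptw: "w * R \<le> 2 * R * cnt Al (x - m) (3 * m) + 2 * w * cnt D (x - m) (4 * m)" for x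
  proof (cases "R < 2 * cnt D (x - m) (4 * m)")
    case True
    then have "w * R \<le> w * (2 * cnt D (x - m) (4 * m))" using w0 by (intro mult_left_mono) auto
    moreover have "0 \<le> 2 * R * cnt Al (x - m) (3 * m)" using R0 cnt_nonneg by simp
    ultimately show ?thesis by simp
  next
    case False
    have light: "2 * N y \<le> R" if "y \<in> {x - m..<x + 2 * m}" for y
    proof -
      have "N y \<le> cnt D (x - m) (4 * m)" unfolding N_def using that by (intro cnt_mono) auto
      then show ?thesis using False by simp
    qed
    have eq: "cnt Al (x - m) (3 * m) = cnt A (x - m) (3 * m)"
      unfolding cnt_def using light by (intro arg_cong[of _ _ "\<lambda>S. int (card S)"]) (auto simp: light_iff)
    have "w \<le> cnt D x (2 * m)" using z by (simp add: w_def)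
    also have "\<dots> \<le> cnt A x (2 * m) + cnt A (x - m) (2 * m)"
    proof -
      have "({x..<x + 2 * m} \<inter> \<phi> -` D)
          \<subseteq> ({x..<x + 2 * m} \<inter> \<phi> -` A) \<union> (\<lambda>y. y + m) ` ({x - m..<x - m + 2 * m} \<inter> \<phi> -` A)"
      proof
        fix y assume y: "y \<in> ({x..<x + 2 * m} \<inter> \<phi> -` D)"
        show "y \<in> ({x..<x + 2 * m} \<inter> \<phi> -` A) \<union> (\<lambda>y. y + m) ` ({x - m..<x - m + 2 * m} \<inter> \<phi> -` A)"
        proof (cases "\<phi> y \<in> A")
          case False
          then have "\<phi> (y - m) \<in> A" using y by (auto simp: D_def phi_diff)
          then have "y - m \<in> ({x - m..<x - m + 2 * m} \<inter> \<phi> -` A)" using y by auto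
          then show ?thesis by (metis UnI2 diff_add_cancel image_eqI)
        qed (use y in auto)
      qed
      then have "card ({x..<x + 2 * m} \<inter> \<phi> -` D)
        \<le> card (({x..<x + 2 * m} \<inter> \<phi> -` A) \<union> (\<lambda>y. y + m) ` ({x - m..<x - m + 2 * m} \<inter> \<phi> -` A))"
        by (intro card_mono) auto
      also have "\<dots> \<le> card ({x..<x + 2 * m} \<inter> \<phi> -` A) + card ((\<lambda>y. y + m) ` ({x - m..<x - m + 2 * m} \<inter> \<phi> -` A))"
        by (rule card_Un_le)
      also have "card ((\<lambda>y. y + m) ` ({x - m..<x - m + 2 * m} \<inter> \<phi> -` A)) = card ({x - m..<x - m + 2 * m} \<inter> \<phi> -` A)"
        by (intro card_image) (auto simp: inj_on_def)
      finally show ?thesis unfolding cnt_def by linarith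
    qed
    also have "\<dots> \<le> cnt A (x - m) (3 * m) + cnt A (x - m) (3 * m)"
      using m by (intro add_mono[OF cnt_mono cnt_mono]) auto
    finally have "w \<le> 2 * cnt Al (x - m) (3 * m)" using eq by simp
    then have "w * R \<le> 2 * cnt Al (x - m) (3 * m) * R" using R0 by (intro mult_right_mono) auto
    moreover have "0 \<le> 2 * w * cnt D (x - m) (4 * m)" using w0 cnt_nonneg by simp
    ultimately show ?thesis by (simp add: ac_simps)
  qed
  \<comment> \<open>Averaging with \<open>card Al \<le> 16 * w\<close> and
    \<open>card D \<le> 16 * R\<close> gives the constant 96 + 128 = 224, below the 400 granted by
    the hypothesis on \<open>m\<close>.\<close>
  have "int p * (w * R) = (\<Sum>x\<in>{0..<int p}. w * R)" by simp
  also have "\<dots> \<le> (\<Sum>x\<in>{0..<int p}. 2 * R * cnt Al (x + - m) (3 * m) + 2 * w * cnt D (x + - m) (4 * m))"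
    using ptw by (intro sum_mono) simp
  also have "\<dots> = 2 * R * (3 * m * int (card Al)) + 2 * w * (4 * m * int (card D))"
  proof -
    have "(\<Sum>x\<in>{0..<int p}. cnt Al (x + - m) (3 * m)) = 3 * m * int (card Al)"
      "(\<Sum>x\<in>{0..<int p}. cnt D (x + - m) (4 * m)) = 4 * m * int (card D)"
      using Al fin Dr m by (intro sum_cnt; simp)+
    then show ?thesis unfolding sum.distrib sum_distrib_left[symmetric] by (simp only:)
  qed
  also have "\<dots> \<le> 2 * R * (3 * m * (16 * w)) + 2 * w * (4 * m * (16 * R))"
    using light_few cD R_large R0 w0 m by (intro add_mono mult_left_mono) auto
  also have "\<dots> = 224 * (m * (w * R))" by simp
  finally have 1: "int p * (w * R) \<le> 224 * (m * (w * R))" .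
  have "0 \<le> int (card Al)" by simp
  then have "w > 0" using light_few by linarith
  then have "m * (w * R) > 0" using R_pos m by simp
  moreover have "400 * m * (w * R) \<le> int p * (w * R)" using m w0 R0 by (intro mult_right_mono) auto
  then have "400 * (m * (w * R)) \<le> int p * (w * R)" by (simp only: mult.assoc)
  ultimately show False using 1 by linarith
qed

end

section \<open>Bounded difference set and reduction to an interval\<close>

context cyclic_cover
begin

text \<open>Call a difference popular if its overlap is at least \<open>n / 48\<close>. Two elements
  \<open>b\<close>, \<open>c\<close> of \<open>B\<close> share at least \<open>n / 2\<close>
  elements \<open>u\<close> with \<open>b - u\<close> and \<open>c - u\<close> popular, so
  \<open>b - c\<close> has as many representations over the popular set \<open>S\<close>. As
  \<open>card S \<le> 48 * n\<close>, the constant is \<open>2 * 48\<^sup>2 = 4608\<close>.\<close>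

lemma small_difference_set:
  assumes A: "finite A" "card A = n" and B: "finite B" "card B = n" "B \<subseteq> range \<phi>"
    and p: "2 * n < p"
    and small: "\<And>b c d. b \<in> B \<Longrightarrow> c \<in> B \<Longrightarrow> d \<in> B \<Longrightarrow> card (A + {b, c, d}) < 2 * n - 1"
  shows "card (B + uminus ` B) \<le> 4608 * card B"
proof (cases "n = 0")
  case True
  then show ?thesis using B by simp
next
  case False
  \<comment> \<open>Otherwise the translates by the elements of \<open>C\<close> nearly coincide,
    and Cauchy--Davenport makes the 12-fold sumset of their differences \<open>Q\<close> larger than
    \<open>2 * n\<close>.\<close>
  have sparse: "4 * card {c \<in> B. 48 * overlap A (b - c) < n} < n" if b: "b \<in> B" for b
  proof (rule ccontr)
    define C where "C = {c \<in> B. 48 * overlap A (b - c) < n}"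
    assume "\<not> 4 * card {c \<in> B. 48 * overlap A (b - c) < n} < n"
    then have cC: "n \<le> 4 * card C" by (simp add: C_def)
    have "C \<noteq> {}" using cC False by auto
    then obtain c0 where c0: "c0 \<in> C" by blast
    have fC: "finite C" "C \<subseteq> B" using B by (auto simp: C_def)
    have close: "23 * n + 48 \<le> 24 * overlap A (c - c0)" if c: "c \<in> C" for c
    proof -
      have "48 * overlap A (b - c) < n" "48 * overlap A (b - c0) < n" "c \<in> B" "c0 \<in> B"
        using c c0 by (auto simp: C_def)
      then show ?thesis
        using card_three_translates[OF A(1), of c0 c b] small[of c0 c b] b A(2) by linarith
    qed
    have n48: "48 \<le> n" using close[OF c0] A by (simp add: overlap_0)
    define Q where "Q = (\<lambda>c. c - c0) ` C"
    have Q: "finite Q" "Q \<noteq> {}" "card Q = card C"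
      using fC c0 by (auto simp: Q_def card_image inj_on_def)
    \<comment> \<open>Each summand costs at most \<open>n / 24\<close> of the overlap; after twelve
      summands half of \<open>A\<close> remains, which caps \<open>card Z\<close> at
      \<open>2 * n\<close>.\<close>
    have near: "24 * n \<le> 24 * overlap A x + j * n" if "x \<in> nsum j Q" for x j
      using that
    proof (induction j arbitrary: x)
      case 0
      then show ?case using A by (simp add: overlap_0)
    next
      case (Suc j)
      then obtain q y where qy: "q \<in> Q" "y \<in> nsum j Q" "x = q + y" by (auto simp: set_plus_def)
      then have "23 * n + 48 \<le> 24 * overlap A q" using close by (auto simp: Q_def)
      moreover have "24 * n \<le> 24 * overlap A y + j * n" using Suc.IH qy by blast
      ultimately show ?case using overlap_add[OF A(1), of q y] A(2) qy(3) by simp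
    qed
    define Z where "Z = nsum 12 Q"
    have fZ: "finite Z" unfolding Z_def by (rule finite_nsum[OF Q(1)])
    have "real n / 2 \<le> real (overlap A x)" if "x \<in> Z" for x
    proof -
      have "n \<le> 2 * overlap A x" using near[of x 12] that unfolding Z_def by linarith
      then show ?thesis by linarith
    qed
    then have "real n / 2 * real (card Z) \<le> (real n)\<^sup>2"
      using card_popular_le[OF A(1) fZ, of "real n / 2"] A by simp
    then have "real n * real (card Z) \<le> real n * (2 * real n)" by (simp add: power2_eq_square)
    then have Zup: "card Z \<le> 2 * n" using n48 by simp
    have "min p (12 * (card Q - 1) + 1) \<le> card Z"
      unfolding Z_def
    proof (rule card_nsum_ge[OF Q(1,2) p_pos])
      fix S d assume S: "finite S" "S \<noteq> {}" "d \<in> Q + uminus ` Q" "d \<noteq> 0" "(+) d ` S \<subseteq> S"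
      then obtain c c' where "c \<in> B" "c' \<in> B" "d = c - c'"
        using fC by (auto simp: Q_def set_plus_def)
      then obtain u v where "d = \<phi> u - \<phi> v" using B by blast
      then have "d = \<phi> (u - v)" by (simp add: phi_diff)
      then show "p \<le> card S" using S by (intro card_translation_closed) auto
    qed
    then show False using Zup p cC n48 Q(3) by linarith
  qed
  define D where "D = B + uminus ` B"
  define S where "S = {x \<in> D. n \<le> 48 * overlap A x}"
  have fD: "finite D" using B by (auto simp: D_def intro!: finite_set_plus)
  have fS: "finite S" using fD by (simp add: S_def)
  have "real n / 48 * real (card S) \<le> (real n)\<^sup>2"
  proof -
    have "real n / 48 \<le> real (overlap A x)" if "x \<in> S" for x
      using that by (simp add: S_def)
    then show ?thesis using card_popular_le[OF A(1) fS, of "real n / 48"] A by simp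
  qed
  then have "real n * real (card S) \<le> real n * (48 * real n)" by (simp add: power2_eq_square)
  then have cS: "card S \<le> 48 * n" using False by simp
  have reps: "real n / 2 \<le> real (card {q \<in> S \<times> S. fst q - snd q = z})" if z: "z \<in> D" for z
  proof -
    obtain b c where "b \<in> B" "c \<in> B" "z = b + - c" using z by (force simp: D_def set_plus_def)
    then have bc: "b \<in> B" "c \<in> B" "z = b - c" by simp_all
    define U where "U = {u \<in> B. b - u \<in> S \<and> c - u \<in> S}"
    let ?F = "\<lambda>b. {u \<in> B. 48 * overlap A (b - u) < n}"
    have mem: "x - u \<in> D" if "x \<in> B" "u \<in> B" for x u
      using that set_plus_intro[of x B "- u" "uminus ` B"] by (simp add: D_def)
    have "B \<subseteq> U \<union> (?F b \<union> ?F c)" using bc mem by (auto simp: U_def S_def not_less)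
    then have "card B \<le> card (U \<union> (?F b \<union> ?F c))" using B by (intro card_mono) (auto simp: U_def)
    also have "\<dots> \<le> card U + (card (?F b) + card (?F c))"
      by (intro order_trans[OF card_Un_le] add_left_mono card_Un_le)
    finally have "n \<le> 2 * card U" using sparse[OF bc(1)] sparse[OF bc(2)] B by linarith
    moreover have "card U \<le> card {q \<in> S \<times> S. fst q - snd q = z}"
      using fS bc by (intro card_inj_on_le[of "\<lambda>u. (b - u, c - u)"]) (auto simp: U_def inj_on_def)
    ultimately show ?thesis by linarith
  qed
  have "real n / 2 * real (card D) \<le> real (card (S \<times> S))"
    using fS fD reps by (intro card_fibres_le) auto
  then have "real n * real (card D) \<le> 2 * (real (card S))\<^sup>2"
    by (simp add: card_cartesian_product power2_eq_square)
  also have "\<dots> \<le> 2 * (real (48 * n))\<^sup>2"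
    using cS by (intro mult_left_mono power_mono of_nat_mono) auto
  finally have "real n * real (card D) \<le> real n * (4608 * real n)"
    by (simp add: power2_eq_square)
  then show ?thesis using False B by (simp add: D_def)
qed

text \<open>Shrinking the interval to the span of the lifts of \<open>B\<close> puts both endpoints
  in \<open>J\<close>; the shift by the least lift is absorbed into \<open>A\<close>.\<close>

lemma three_translates_of_concentrated:
  assumes A: "finite A" "A \<subseteq> range \<phi>" "card A = n"
    and B: "card B = n" "2 \<le> n" "B \<subseteq> \<phi> ` {a..a + l}" "400 * l \<le> int p"
  shows "\<exists>b\<in>B. \<exists>c\<in>B. \<exists>d\<in>B. 2 * n - 1 \<le> card (A + {b, c, d})"
proof -
  define K where "K = {a..a + l} \<inter> \<phi> -` B"
  have im: "\<phi> ` K = B" using B by (auto simp: K_def)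
  have "l \<ge> 0" using B by (cases "l \<ge> 0") auto
  then have "inj_on \<phi> {a..<a + (l + 1)}" using B p_pos by (intro inj_on_phi) auto
  then have "inj_on \<phi> K" by (rule inj_on_subset) (auto simp: K_def)
  then have cK: "card K = n" using card_image[of \<phi> K] im B by simp
  have K: "finite K" "K \<noteq> {}" using cK B by (auto simp: K_def)
  define lo where "lo = Min K"
  define m where "m = Max K - lo"
  have lo: "lo \<in> K" "\<And>k. k \<in> K \<Longrightarrow> lo \<le> k" using K by (auto simp: lo_def)
  have hi: "Max K \<in> K" "\<And>k. k \<in> K \<Longrightarrow> k \<le> Max K" using K by auto
  define J where "J = (\<lambda>k. k - lo) ` K"
  have J: "J \<subseteq> {0..m}" "0 \<in> J" "m \<in> J" "card J = n"
    using lo hi cK by (auto simp: J_def m_def card_image inj_on_def)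
  have "m \<noteq> 0"
  proof
    assume "m = 0"
    then have "card J \<le> card {0::int}" using J by (intro card_mono) auto
    then show False using J B by simp
  qed
  then have "0 < m" using J by force
  moreover have "m \<le> l" using lo(1) hi(1) by (auto simp: K_def m_def)
  then have "400 * m \<le> int p" using B by linarith
  moreover define A' where "A' = (+) (\<phi> lo) ` A"
  have "A' \<subseteq> range \<phi>"
  proof
    fix x assume "x \<in> A'"
    then obtain u where "x = \<phi> lo + \<phi> u" using A by (auto simp: A'_def)
    then have "x = \<phi> (lo + u)" by (simp add: hom)
    then show "x \<in> range \<phi>" by blast
  qed
  ultimately obtain i j k where ijk: "i \<in> J" "j \<in> J" "k \<in> J" "2 * n - 1 \<le> card (A' + {\<phi> i, \<phi> j, \<phi> k})"
    using three_translates_of_interval[of A' n J m] A J by (auto simp: A'_def)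
  have "A' + {\<phi> i, \<phi> j, \<phi> k} = A + {\<phi> (lo + i), \<phi> (lo + j), \<phi> (lo + k)}"
    by (auto simp: A'_def set_plus_def hom ac_simps)
  then have "2 * n - 1 \<le> card (A + {\<phi> (lo + i), \<phi> (lo + j), \<phi> (lo + k)})" using ijk by simp
  moreover have "\<phi> (lo + x) \<in> B" if "x \<in> J" for x using that im by (auto simp: J_def)
  ultimately show ?thesis using ijk(1-3) by blast
qed

lemma cyclic_cover_dilate:
  assumes "\<not> int p dvd u"
  shows "cyclic_cover (\<lambda>k. \<phi> (k * u)) p"
proof
  show "prime p" by (rule prime)
  show "\<phi> ((x + y) * u) = \<phi> (x * u) + \<phi> (y * u)" for x y
    by (simp only: distrib_right hom)
  have pp: "prime (int p)" using prime by simp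
  show "\<phi> (x * u) = 0 \<longleftrightarrow> int p dvd x" for x
    using assms prime_dvd_mult_iff[OF pp, of x u] ker[of "x * u"] by simp
qed

end

section \<open>Roots of unity as a model of the cyclic group\<close>

definition rootp :: "nat \<Rightarrow> int \<Rightarrow> circle" where
  "rootp p k = rot (2 * pi * (real_of_int k / real p))"

lemma cval_rootp: "cval (rootp p k) = cis (2 * pi * (real_of_int k / real p))"
  by (simp add: rootp_def)

lemma cyclic_cover_rootp:
  assumes "prime p"
  shows "cyclic_cover (rootp p) p"
proof
  have p: "p > 0" using assms prime_gt_0_nat by blast
  show "prime p" by fact
  show "rootp p (x + y) = rootp p x + rootp p y" for x y
    by (simp add: cval_rootp cis_mult add_divide_distrib distrib_left flip: cval_inject)
  show "rootp p x = 0 \<longleftrightarrow> int p dvd x" for x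
  proof -
    have "rootp p x = 0 \<longleftrightarrow> (\<exists>n. 2 * pi * (real_of_int x / real p) = of_int n * (2 * pi))"
      by (simp add: cval_rootp cis_eq_1_iff flip: cval_inject)
    also have "\<dots> \<longleftrightarrow> (\<exists>n. real_of_int x = real_of_int (int p * n))"
      using p by (simp add: field_simps)
    also have "\<dots> \<longleftrightarrow> int p dvd x" by (simp only: of_int_eq_iff dvd_def)
    finally show ?thesis .
  qed
qed

lemma rootp_power: "cval (rootp p k) ^ t = cval (rootp p (k * int t))"
  by (simp add: cval_rootp DeMoivre ac_simps)

lemma rootp_roots: "p > 0 \<Longrightarrow> range (rootp p) \<subseteq> roots p"
  by (auto simp: roots_def cval_rootp DeMoivre)

lemma norm_cis_diff_squared: "(cmod (cis a - cis b))\<^sup>2 = 2 - 2 * cos (a - b)"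
proof -
  have "(cos a - cos b)\<^sup>2 + (sin a - sin b)\<^sup>2 = 2 - 2 * (cos a * cos b + sin a * sin b)"
    using sin_cos_squared_add[of a] sin_cos_squared_add[of b] by (simp add: power2_eq_square algebra_simps)
  then show ?thesis by (simp add: cmod_power2 cos_diff)
qed

text \<open>A counterexample has a small difference set, hence a frequency \<open>t\<close> at which
  \<open>B\<close> is concentrated. Dilating by the inverse of \<open>t\<close> places
  \<open>B\<close> in a short interval.\<close>

lemma three_translates_circle:
  "\<exists>\<alpha>::real. \<alpha> > 0 \<and> (\<forall>p A B n. prime p \<longrightarrow> A \<subseteq> range (rootp p) \<longrightarrow> B \<subseteq> range (rootp p) \<longrightarrow>
    finite A \<longrightarrow> finite B \<longrightarrow> B \<noteq> {} \<longrightarrow> card A = n \<longrightarrow> card B = n \<longrightarrow> real n \<le> \<alpha> * real p \<longrightarrow>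
    (\<exists>b\<in>B. \<exists>c\<in>B. \<exists>d\<in>B. 2 * n - 1 \<le> card (A + {b, c, d})))"
proof -
  \<comment> \<open>The squared chord of the angle \<open>pi / 400\<close>, which corresponds to a
    displacement of \<open>p / 800\<close>; allowing it on both sides of \<open>b0\<close> gives
    length \<open>p / 400\<close>.\<close>
  define \<delta> where "\<delta> = 2 - 2 * cos (pi / 400)"
  have "cos (pi / 400) < cos 0" by (intro cos_monotone_0_pi) auto
  then have "\<delta> > 0" by (simp add: \<delta>_def)
  then obtain \<alpha>0 where \<alpha>0: "\<alpha>0 > 0"
    "\<And>p B. finite B \<Longrightarrow> B \<noteq> {} \<Longrightarrow> B \<subseteq> roots p \<Longrightarrow> card (B + uminus ` B) \<le> 4608 * card B \<Longrightarrow>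
       real (card B) \<le> \<alpha>0 * real p \<Longrightarrow>
       \<exists>t\<in>{1..<p}. \<forall>b\<in>B. \<forall>c\<in>B. (cmod (cval b ^ t - cval c ^ t))\<^sup>2 \<le> \<delta>"
    using exists_concentrating_frequency[of \<delta> 4608] by metis
  show ?thesis
  \<comment> \<open>The bound \<open>1/3\<close> secures \<open>2 * n < p\<close> for
    \<open>small_difference_set\<close>.\<close>
  proof (intro exI[of _ "min \<alpha>0 (1/3)"] conjI allI impI)
    show "min \<alpha>0 (1/3) > 0" using \<alpha>0 by simp
    fix p n and A B :: "circle set"
    assume p: "prime p" and A: "finite A" "A \<subseteq> range (rootp p)" "card A = n"
      and B: "finite B" "B \<subseteq> range (rootp p)" "B \<noteq> {}" "card B = n"
      and n: "real n \<le> min \<alpha>0 (1/3) * real p"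
    interpret cyclic_cover "rootp p" p using p by (rule cyclic_cover_rootp)
    show "\<exists>b\<in>B. \<exists>c\<in>B. \<exists>d\<in>B. 2 * n - 1 \<le> card (A + {b, c, d})"
    proof (rule ccontr)
      assume neg: "\<not> ?thesis"
      then have small: "card (A + {b, c, d}) < 2 * n - 1" if "b \<in> B" "c \<in> B" "d \<in> B" for b c d
        using that by force
      obtain b0 where b0: "b0 \<in> B" using B by blast
      \<comment> \<open>Taking the same element three times leaves a single translate of
        \<open>A\<close>.\<close>
      have "n < 2 * n - 1" using small[OF b0 b0 b0] A by (simp add: card_plus_sing)
      then have n2: "n \<ge> 2" by linarith
      have "min \<alpha>0 (1/3) * real p \<le> 1/3 * real p" "min \<alpha>0 (1/3) * real p \<le> \<alpha>0 * real p"
        by (intro mult_right_mono; simp)+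
      then have n': "real n \<le> \<alpha>0 * real p" "3 * n \<le> p" using n by linarith+
      have "2 * n < p" using n' n2 by linarith
      then have "card (B + uminus ` B) \<le> 4608 * card B"
        using A B small by (intro small_difference_set[of A n]) auto
      moreover have "B \<subseteq> roots p" using B(2) rootp_roots[OF p_pos] by blast
      ultimately have "\<exists>t\<in>{1..<p}. \<forall>b\<in>B. \<forall>c\<in>B. (cmod (cval b ^ t - cval c ^ t))\<^sup>2 \<le> \<delta>"
        using B n'(1) by (intro \<alpha>0(2)) auto
      then obtain t where t: "t \<in> {1..<p}"
        and conc: "\<And>b c. b \<in> B \<Longrightarrow> c \<in> B \<Longrightarrow> (cmod (cval b ^ t - cval c ^ t))\<^sup>2 \<le> \<delta>"
        by blast
      have "\<not> int p dvd int t" using t by (auto dest: zdvd_imp_le)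
      then have "coprime (int t) (int p)"
        using p by (metis coprime_commute prime_imp_coprime prime_nat_int_transfer)
      \<comment> \<open>\<open>u\<close> inverts \<open>t\<close> modulo \<open>p\<close>, so in the
        coordinate \<open>k\<close> of \<open>rootp p (k * u)\<close> the frequency \<open>t\<close>
        becomes 1.\<close>
      then obtain u v where uv: "u * int t + v * int p = 1"
        using bezout_int[of "int t" "int p"] by (metis coprime_imp_gcd_eq_1)
      have "\<not> int p dvd u"
      proof
        assume "int p dvd u"
        then have "int p dvd u * int t + v * int p" by simp
        then have "int p \<le> 1" unfolding uv by (intro zdvd_imp_le) auto
        then show False using prime_gt_1_nat[OF p] by simp
      qed
      then interpret dil: cyclic_cover "\<lambda>k. rootp p (k * u)" p by (rule cyclic_cover_dilate)
      have ut: "rootp p (k * (u * int t)) = rootp p k" for k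
      proof -
        have "k * (u * int t) - k = k * (u * int t + v * int p) - k - int p * (k * v)"
          by (simp add: algebra_simps)
        also have "\<dots> = int p * (- (k * v))" by (simp add: uv)
        finally have "int p dvd k * (u * int t) - k" by simp
        then show ?thesis by (simp add: phi_eq_iff)
      qed
      have ran: "range (rootp p) \<subseteq> range (\<lambda>k. rootp p (k * u))"
      proof
        fix x assume "x \<in> range (rootp p)"
        then obtain k where "x = rootp p k" by blast
        then have "x = rootp p (k * int t * u)" using ut[of k] by (simp add: ac_simps)
        then show "x \<in> range (\<lambda>k. rootp p (k * u))" by blast
      qed
      obtain k0 where k0: "b0 = rootp p (k0 * u)" using b0 B ran by blast
      have cover: "B \<subseteq> (\<lambda>k. rootp p (k * u)) ` {k0 - int p div 800..k0 - int p div 800 + 2 * (int p div 800)}"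
      proof
        fix b assume b: "b \<in> B"
        then obtain k where k: "b = rootp p (k * u)" using B ran by blast
        \<comment> \<open>The residue of \<open>k - k0\<close> of least absolute value. Its angle is
          at most \<open>pi\<close>, where the cosine is decreasing and can be inverted.\<close>
        define j where "j = (k - k0 + int p div 2) mod int p - int p div 2"
        have jb: "2 * \<bar>j\<bar> \<le> int p"
        proof -
          have "0 \<le> (k - k0 + int p div 2) mod int p" "(k - k0 + int p div 2) mod int p < int p"
            using p_pos by auto
          moreover have "2 * (int p div 2) \<le> int p" "int p \<le> 2 * (int p div 2) + 1" by linarith+
          ultimately show ?thesis unfolding j_def by (simp add: abs_if)
        qed
        have "int p dvd k0 + j - k"
        proof -
          have "k0 + j - k = (k - k0 + int p div 2) mod int p - (k - k0 + int p div 2)" by (simp add: j_def)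
          moreover have "int p dvd y mod int p - y" for y by (simp flip: mod_eq_dvd_iff)
          ultimately show ?thesis by (simp only:)
        qed
        then have bj: "b = rootp p ((k0 + j) * u)" using k dil.phi_eq_iff[of "k0 + j" k] by simp
        have pow: "cval (rootp p (i * u)) ^ t = cis (2 * pi * (real_of_int i / real p))" for i
          unfolding rootp_power mult.assoc[of i] ut by (rule cval_rootp)
        have "2 * pi * (real_of_int (k0 + j) / real p) - 2 * pi * (real_of_int k0 / real p)
            = 2 * pi * (real_of_int j / real p)"
          by (simp add: add_divide_distrib distrib_left)
        then have "(cmod (cval b ^ t - cval b0 ^ t))\<^sup>2 = 2 - 2 * cos (2 * pi * (real_of_int j / real p))"
          unfolding bj k0 pow norm_cis_diff_squared by simp
        then have "cos (pi / 400) \<le> cos (2 * pi * (real_of_int j / real p))"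
          using conc[OF b b0] by (simp add: \<delta>_def)
        also have "\<dots> = cos \<bar>2 * pi * (real_of_int j / real p)\<bar>" by (rule cos_abs_real[symmetric])
        also have "\<bar>2 * pi * (real_of_int j / real p)\<bar> = 2 * pi * (\<bar>real_of_int j\<bar> / real p)"
          by (simp add: abs_mult)
        finally have cosj: "cos (pi / 400) \<le> cos (2 * pi * (\<bar>real_of_int j\<bar> / real p))" .
        have "2 * \<bar>real_of_int j\<bar> \<le> real p" using jb by linarith
        then have "2 * pi * (\<bar>real_of_int j\<bar> / real p) \<le> pi" using p_pos by (simp add: field_simps)
        then have "2 * pi * (\<bar>real_of_int j\<bar> / real p) \<le> pi / 400"
          using cosj cos_monotone_0_pi[of "pi / 400" "2 * pi * (\<bar>real_of_int j\<bar> / real p)"] by (force simp: not_le)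
        then have "800 * \<bar>real_of_int j\<bar> \<le> real p" using p_pos by (simp add: field_simps)
        then have "800 * \<bar>j\<bar> \<le> int p" by linarith
        then have "k0 + j \<in> {k0 - int p div 800..k0 - int p div 800 + 2 * (int p div 800)}" by auto
        then show "b \<in> (\<lambda>k. rootp p (k * u)) ` {k0 - int p div 800..k0 - int p div 800 + 2 * (int p div 800)}"
          using bj by blast
      qed
      have "A \<subseteq> range (\<lambda>k. rootp p (k * u))" using A ran by blast
      moreover have "400 * (2 * (int p div 800)) \<le> int p" by linarith
      ultimately show False
        using neg dil.three_translates_of_concentrated[OF A(1) _ A(3) B(4) n2 cover] by blast
    qed
  qed
qed

section \<open>Transfer to residues modulo p\<close>

theorem theorem1p3:
  shows "\<exists>\<alpha>::real. \<alpha> > 0 \<and>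
    (\<forall>p::nat. \<forall>A B :: nat set. \<forall>n::nat.
       prime p \<longrightarrow> A \<subseteq> {0..<p} \<longrightarrow> B \<subseteq> {0..<p} \<longrightarrow>
       A \<noteq> {} \<longrightarrow> B \<noteq> {} \<longrightarrow> card A = n \<longrightarrow> card B = n \<longrightarrow>
       real n \<le> \<alpha> * real p \<longrightarrow>
       (\<exists>B3. B3 \<subseteq> B \<and> card B3 \<le> 3 \<and> card (sumset_mod p A B3) \<ge> 2 * n - 1))"
proof -
  obtain \<alpha> :: real where \<alpha>: "\<alpha> > 0"
    and three: "\<forall>p A B n. prime p \<longrightarrow> A \<subseteq> range (rootp p) \<longrightarrow> B \<subseteq> range (rootp p) \<longrightarrow>
      finite A \<longrightarrow> finite B \<longrightarrow> B \<noteq> {} \<longrightarrow> card A = n \<longrightarrow> card B = n \<longrightarrow> real n \<le> \<alpha> * real p \<longrightarrow>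
      (\<exists>b\<in>B. \<exists>c\<in>B. \<exists>d\<in>B. 2 * n - 1 \<le> card (A + {b, c, d}))"
    using three_translates_circle by blast
  have "\<exists>B3. B3 \<subseteq> B \<and> card B3 \<le> 3 \<and> card (sumset_mod p A B3) \<ge> 2 * n - 1"
    if p: "prime p" and A: "A \<subseteq> {0..<p}" "card A = n" and B: "B \<subseteq> {0..<p}" "B \<noteq> {}" "card B = n"
      and n: "real n \<le> \<alpha> * real p" for p A B n
  proof -
    interpret cyclic_cover "rootp p" p using p by (rule cyclic_cover_rootp)
    let ?f = "\<lambda>k::nat. rootp p (int k)"
    have fin: "finite A" "finite B" using A B finite_subset by auto
    have inj: "inj_on ?f {0..<p}" using inj_on_phi[of "int p" 0] by (force simp: inj_on_def)
    have c: "card (?f ` A) = n" "card (?f ` B) = n"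
      using A B inj card_image inj_on_subset by metis+
    obtain x y z where xyz: "x \<in> B" "y \<in> B" "z \<in> B" "2 * n - 1 \<le> card (?f ` A + {?f x, ?f y, ?f z})"
      using three[rule_format, OF p, of "?f ` A" "?f ` B" n] fin c B n by blast
    \<comment> \<open>\<open>rootp\<close> is unchanged by reduction modulo \<open>p\<close>, so the
      sums on the circle are images of elements of the modular sumset.\<close>
    have sub: "?f ` A + {?f x, ?f y, ?f z} \<subseteq> ?f ` sumset_mod p A {x, y, z}"
    proof
      fix s assume "s \<in> ?f ` A + {?f x, ?f y, ?f z}"
      then obtain a b where ab: "a \<in> A" "b \<in> {x, y, z}" "s = ?f a + ?f b" by (auto simp: set_plus_def)
      then have "s = ?f ((a + b) mod p)" by (simp add: hom of_nat_mod)
      then show "s \<in> ?f ` sumset_mod p A {x, y, z}" using ab unfolding sumset_mod_def by blast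
    qed
    have "sumset_mod p A {x, y, z} \<subseteq> {0..<p}" using p_pos by (auto simp: sumset_mod_def)
    then have f3: "finite (sumset_mod p A {x, y, z})" using finite_subset by blast
    have "card (?f ` A + {?f x, ?f y, ?f z}) \<le> card (sumset_mod p A {x, y, z})"
      using card_mono[OF _ sub] card_image_le[OF f3, of ?f] f3 by (meson finite_imageI order_trans)
    moreover have "card {x, y, z} \<le> 3" by (simp add: card_insert_if)
    ultimately show ?thesis using xyz by (intro exI[of _ "{x, y, z}"]) auto
  qed
  with \<alpha> show ?thesis by blast
qed

end
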